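(* Consider a production-destruction system $y_k'=\sum_{\nu=1}^N(p_{k\nu}(\mathbf y)-d_{k\nu}(\mathbf y))$, $k=1,\dots,N$, with $p_{k\nu}=d_{\nu k}$, $p_{kk}=d_{kk}=0$ and $p_{k\nu},d_{k\nu}\ge0$ (for positive arguments), such that the functions $\mathbf F^{[\nu]}$ defined in the context are Lipschitz continuous and of class $\mathcal C^5$. For a positive $\mathbf y^n$ and step size $h$ define $\hat{\mathbf y}^{(2)}=\hat{\mathbf y}^{(2)}(h)$ and $\hat{\boldsymbol\sigma}=\hat{\boldsymbol\sigma}(h)$ by $$\hat y^{(2)}_k=y^n_k+\tfrac12h\sum_{\nu=1}^N\Big(p_{k\nu}(\mathbf y^n)\frac{\hat y^{(2)}_\nu}{y^n_\nu}-d_{k\nu}(\mathbf y^n)\frac{\hat y^{(2)}_k}{y^n_k}\Big),$$ $$\hat\sigma_k=y^n_k+h\sum_{\nu=1}^N\Big(p_{k\nu}(\hat{\mathbf y}^{(2)})\frac{\hat\sigma_\nu}{(\hat y^{(2)}_\nu)^2(y^n_\nu)^{-1}}-d_{k\nu}(\hat{\mathbf y}^{(2)})\frac{\hat\sigma_k}{(\hat y^{(2)}_k)^2(y^n_k)^{-1}}\Big),$$ then $$\hat y^{(3)}_k=y^n_k+\tfrac34h\sum_{\nu=1}^N\Big(p_{k\nu}(\hat{\mathbf y}^{(2)})\frac{\hat y^{(3)}_\nu}{(\hat y^{(2)}_\nu)^2(y^n_\nu)^{-1}}-d_{k\nu}(\hat{\mathbf y}^{(2)})\frac{\hat y^{(3)}_k}{(\hat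 y^{(2)}_k)^2(y^n_k)^{-1}}\Big),$$ $$\hat y^{n+1}_k=y^n_k+\tfrac19h\sum_{\nu=1}^N\Big(\big(2p_{k\nu}(\mathbf y^n)+3p_{k\nu}(\hat{\mathbf y}^{(2)})+4p_{k\nu}(\hat{\mathbf y}^{(3)})\big)\frac{\hat y^{n+1}_\nu}{\hat\sigma_\nu}-\big(2d_{k\nu}(\mathbf y^n)+3d_{k\nu}(\hat{\mathbf y}^{(2)})+4d_{k\nu}(\hat{\mathbf y}^{(3)})\big)\frac{\hat y^{n+1}_k}{\hat\sigma_k}\Big),$$ and set $\rho_{2\nu}=\rho_{3\nu}=\hat\sigma_\nu(\tfrac12h)$, $\rho_{4\nu}=\hat\sigma_\nu(h)$, $\sigma_\nu=\hat y^{n+1}_\nu$. Then the scheme $$y^{(2)}_k=y^n_k+\tfrac12h\sum_{\nu}\Big(p_{k\nu}(\mathbf y^n)\frac{y^{(2)}_\nu}{\rho_{2\nu}}-d_{k\nu}(\mathbf y^n)\frac{y^{(2)}_k}{\rho_{2k}}\Big),\qquad y^{(3)}_k=y^n_k+\tfrac12h\sum_{\nu}\Big(p_{k\nu}(\mathbf y^{(2)})\frac{y^{(3)}_\nu}{\rho_{3\nu}}-d_{k\nu}(\mathbf y^{(2)})\frac{y^{(3)}_k}{\rho_{3k}}\Big),$$ $$y^{(4)}_k=y^n_k+h\sum_{\nu}\Big(p_{k\nu}(\mathbf y^{(3)})\frac{y^{(4)}_\nu}{\rho_{4\nu}}-d_{k\nu}(\mathbf y^{(3)})\frac{y^{(4)}_k}{\rho_{4k}}\Big),$$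 $$y^{n+1}_k=y^n_k+\tfrac16h\sum_{\nu}\Big(\big(p_{k\nu}(\mathbf y^n)+2p_{k\nu}(\mathbf y^{(2)})+2p_{k\nu}(\mathbf y^{(3)})+p_{k\nu}(\mathbf y^{(4)})\big)\frac{y^{n+1}_\nu}{\sigma_\nu}-\big(d_{k\nu}(\mathbf y^n)+2d_{k\nu}(\mathbf y^{(2)})+2d_{k\nu}(\mathbf y^{(3)})+d_{k\nu}(\mathbf y^{(4)})\big)\frac{y^{n+1}_k}{\sigma_k}\Big)$$ ($k=1,\dots,N$) is of order $4$.
   Context: $\mathbf F^{[\nu]}$ has components $F^{[\nu]}_m=p_{m\nu}$ for $\nu\ne m$ and $F^{[m]}_m=-\sum_{j=1}^N d_{mj}$, so the system is $\mathbf y'=\sum_{\nu=1}^N\mathbf F^{[\nu]}(\mathbf y)$. Each displayed equation is a linear system for the unknown on its left-hand side. $\hat\sigma_\nu(\tfrac12h)$ means that $\hat{\mathbf y}^{(2)}$ and $\hat{\boldsymbol\sigma}$ are computed from $\mathbf y^n$ with $h$ replaced by $\tfrac12 h$ in their defining equations. Order $4$ means: whenever $\mathbf y^n=\mathbf y(t_n)$ is positive for a solution $\mathbf y$, $\mathbf y^{n+1}=\mathbf y(t_n+h)+\mathcal O(h^5)$ as $h\to0$. *)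

theory Defs
  imports "HOL-Analysis.Analysis" "HOL-Library.Landau_Symbols"
begin

definition positive_orthant :: "(real ^ 'n) set" where
  "positive_orthant = {x. \<forall>k. 0 < x $ k}"

(* On an open set S this is the class C^k: all iterated directional derivatives up to
   order k exist in the Frechet sense and are continuous. The recursion goes through
   directional derivatives so that the codomain stays the same at every order. *)
fun Ck_on :: "nat \<Rightarrow> 'a set \<Rightarrow> ('a::real_normed_vector \<Rightarrow> 'b::real_normed_vector) \<Rightarrow> bool" where
  "Ck_on 0 S f \<longleftrightarrow> continuous_on S f"
| "Ck_on (Suc k) S f \<longleftrightarrow>
     (\<forall>x\<in>S. f differentiable (at x)) \<and>
     (\<forall>v. Ck_on k S (\<lambda>x. frechet_derivative f (at x) v))"

type_synonym 'n rates = "'n \<Rightarrow> 'n \<Rightarrow> real ^ 'n \<Rightarrow> real"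

definition pds_rhs :: "'n::finite rates \<Rightarrow> 'n rates \<Rightarrow> real ^ 'n \<Rightarrow> real ^ 'n" where
  "pds_rhs p d x = (\<chi> k. \<Sum>\<nu>\<in>UNIV. p k \<nu> x - d k \<nu> x)"

(* F^[nu]; they sum to pds_rhs wherever p vanishes on the diagonal *)
definition pds_part :: "'n::finite rates \<Rightarrow> 'n rates \<Rightarrow> 'n \<Rightarrow> real ^ 'n \<Rightarrow> real ^ 'n" where
  "pds_part p d \<nu> x = (\<chi> m. if m = \<nu> then - (\<Sum>j\<in>UNIV. d m j x) else p m \<nu> x)"

(* The rates are constrained on positive arguments only; their values elsewhere are arbitrary. *)
definition production_destruction :: "'n::finite rates \<Rightarrow> 'n rates \<Rightarrow> bool" where
  "production_destruction p d \<longleftrightarrow>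
     (\<forall>x\<in>positive_orthant. \<forall>k \<nu>.
        p k \<nu> x = d \<nu> k x \<and> p k k x = 0 \<and> d k k x = 0 \<and> 0 \<le> p k \<nu> x \<and> 0 \<le> d k \<nu> x)"

(* z solves the linear system with frozen rates P, D, weight denominators w and factor c,
   the common shape of every stage below *)
definition patankar_eq ::
  "real ^ 'n \<Rightarrow> real \<Rightarrow> ('n \<Rightarrow> 'n \<Rightarrow> real) \<Rightarrow> ('n \<Rightarrow> 'n \<Rightarrow> real) \<Rightarrow> real ^ 'n \<Rightarrow> real ^ 'n::finite \<Rightarrow> bool" where
  "patankar_eq yn c P D w z \<longleftrightarrow>
     (\<forall>k. z $ k = yn $ k + c * (\<Sum>\<nu>\<in>UNIV. P k \<nu> * (z $ \<nu> / w $ \<nu>) - D k \<nu> * (z $ k / w $ k)))"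

(* the denominators (y2_nu)^2 (yn_nu)^(-1) *)
definition hat_weight :: "real ^ 'n \<Rightarrow> real ^ 'n \<Rightarrow> real ^ 'n::finite" where
  "hat_weight yn y2 = (\<chi> \<nu>. (y2 $ \<nu>)\<^sup>2 * inverse (yn $ \<nu>))"

definition hat_sigma ::
  "'n::finite rates \<Rightarrow> 'n rates \<Rightarrow> real ^ 'n \<Rightarrow> real \<Rightarrow> real ^ 'n \<Rightarrow> real ^ 'n \<Rightarrow> bool" where
  "hat_sigma p d yn h y2 s \<longleftrightarrow>
     patankar_eq yn (1/2 * h) (\<lambda>k \<nu>. p k \<nu> yn) (\<lambda>k \<nu>. d k \<nu> yn) yn y2 \<and>
     patankar_eq yn h (\<lambda>k \<nu>. p k \<nu> y2) (\<lambda>k \<nu>. d k \<nu> y2) (hat_weight yn y2) s"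

definition hat_next ::
  "'n::finite rates \<Rightarrow> 'n rates \<Rightarrow> real ^ 'n \<Rightarrow> real \<Rightarrow> real ^ 'n \<Rightarrow> real ^ 'n \<Rightarrow> real ^ 'n \<Rightarrow> bool" where
  "hat_next p d yn h y2 s z \<longleftrightarrow>
     (\<exists>y3.
        patankar_eq yn (3/4 * h) (\<lambda>k \<nu>. p k \<nu> y2) (\<lambda>k \<nu>. d k \<nu> y2) (hat_weight yn y2) y3 \<and>
        patankar_eq yn (1/9 * h)
          (\<lambda>k \<nu>. 2 * p k \<nu> yn + 3 * p k \<nu> y2 + 4 * p k \<nu> y3)
          (\<lambda>k \<nu>. 2 * d k \<nu> yn + 3 * d k \<nu> y2 + 4 * d k \<nu> y3) s z)"

definition rk4_stages ::
  "'n::finite rates \<Rightarrow> 'n rates \<Rightarrow> real ^ 'n \<Rightarrow> real \<Rightarrow>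
   real ^ 'n \<Rightarrow> real ^ 'n \<Rightarrow> real ^ 'n \<Rightarrow> real ^ 'n \<Rightarrow> real ^ 'n \<Rightarrow> bool" where
  "rk4_stages p d yn h \<rho>2 \<rho>3 \<rho>4 \<sigma> z \<longleftrightarrow>
     (\<exists>y2 y3 y4.
        patankar_eq yn (1/2 * h) (\<lambda>k \<nu>. p k \<nu> yn) (\<lambda>k \<nu>. d k \<nu> yn) \<rho>2 y2 \<and>
        patankar_eq yn (1/2 * h) (\<lambda>k \<nu>. p k \<nu> y2) (\<lambda>k \<nu>. d k \<nu> y2) \<rho>3 y3 \<and>
        patankar_eq yn h (\<lambda>k \<nu>. p k \<nu> y3) (\<lambda>k \<nu>. d k \<nu> y3) \<rho>4 y4 \<and>
        patankar_eq yn (1/6 * h)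
          (\<lambda>k \<nu>. p k \<nu> yn + 2 * p k \<nu> y2 + 2 * p k \<nu> y3 + p k \<nu> y4)
          (\<lambda>k \<nu>. d k \<nu> yn + 2 * d k \<nu> y2 + 2 * d k \<nu> y3 + d k \<nu> y4) \<sigma> z)"

(* z is a result of one step of size h from yn; rho_2 = rho_3 = shalf, rho_4 = s *)
definition mprk4_step ::
  "'n::finite rates \<Rightarrow> 'n rates \<Rightarrow> real ^ 'n \<Rightarrow> real \<Rightarrow> real ^ 'n \<Rightarrow> bool" where
  "mprk4_step p d yn h z \<longleftrightarrow>
     (\<exists>y2 s y2half shalf \<sigma>.
        hat_sigma p d yn h y2 s \<and>
        hat_sigma p d yn (1/2 * h) y2half shalf \<and>
        hat_next p d yn h y2 s \<sigma> \<and>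
        rk4_stages p d yn h shalf shalf s \<sigma> z)"

(* Order of an implicitly given one-step method for x' = f x. The first conjunct says that for
   small step sizes the equations determine the result Y h; without it the error bound would be
   vacuous for unsolvable equations. The interval J on which the solution lives may be one-sided
   at t0, which gives h -> 0+, or contain t0 in its interior, which gives the two-sided limit. *)
definition has_order ::
  "(real ^ 'n::finite \<Rightarrow> real ^ 'n) \<Rightarrow> (real ^ 'n \<Rightarrow> real \<Rightarrow> real ^ 'n \<Rightarrow> bool) \<Rightarrow> nat \<Rightarrow> bool" where
  "has_order f step q \<longleftrightarrow>
     (\<forall>J y t0. is_interval J \<and> t0 \<in> J \<and> y t0 \<in> positive_orthant \<and>
        (\<forall>t\<in>J. (y has_vector_derivative f (y t)) (at t within J)) \<longrightarrow>
        (\<exists>Y.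
          (\<forall>\<^sub>F h in at 0 within {h. t0 + h \<in> J}. \<forall>z. step (y t0) h z \<longleftrightarrow> z = Y h) \<and>
          (\<lambda>h. norm (Y h - y (t0 + h))) \<in> O[at 0 within {h. t0 + h \<in> J}](\<lambda>h. h ^ (q + 1))))"

end

theory Submission
  imports Defs
begin

text \<open>Every stage has the form \<open>z = yn + c \<Sum>\<^sub>\<nu> (z\<^sub>\<nu> / w\<^sub>\<nu>) A\<^sub>\<nu>\<close>, a small perturbation of the Runge-Kutta stage
  \<open>yn + c \<Sum>\<^sub>\<nu> A\<^sub>\<nu>\<close>: if \<open>z - w = O(h\<^sup>k)\<close>, the two differ by \<open>O(h\<^sup>k\<^sup>+\<^sup>1)\<close>, with a leading term that is linear in
  the leading term of \<open>z - w\<close>. The stages are compared with the exact solution at the nodes. With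
  \<open>\<delta>\<^sub>i\<close> the deviation of stage \<open>i\<close>, the deviations are \<open>O(h\<^sup>2)\<close>, so only the first derivative of the
  right-hand side enters, and everything reduces to the cancellations
  \<open>3 \<delta>\<^sub>2 + 4 \<delta>\<^sub>3 = O(h\<^sup>3)\<close> for the embedded scheme and \<open>\<delta>\<^sub>2 + \<delta>\<^sub>3 = O(h\<^sup>3)\<close>,
  \<open>2 (\<delta>\<^sub>2 + \<delta>\<^sub>3) + \<delta>\<^sub>4 = O(h\<^sup>4)\<close> for the final one, in which the weight perturbations of stages
  2 and 3 cancel; what remains are quadrature errors along the solution (Simpson's rule for the
  final scheme).\<close>

section \<open>Orders in the step size\<close>

text \<open>Comparison with a solution keeps the elementary differentials of the right-hand side out
  of sight: the solution enters only through its Taylor coefficients, the stages only through the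
  Jacobian \<open>J\<close> at \<open>yn\<close> and the linear map \<open>G\<close>. The obstacle
  is that the weights are themselves computed and every stage is implicit, so the size of
  \<open>z - w\<close>, which governs the perturbation, is not known beforehand. It is bootstrapped:
  both are within O(h) of \<open>yn\<close>, so the stage is known up to O(h^2); comparison with the
  expansion of the weight improves \<open>z - w\<close>, and so on until the two expansions part.
  Step sizes may have either sign, so solvability rests on the smallness of h and not on sign
  patterns of the matrices. The rates obey their relations at positive arguments only, so each stage
  has to be positive for small h before the system built on it can be rewritten. All estimates run
  along a filter below \<open>nhds 0\<close>, which covers one-sided and two-sided limits at
  once.\<close>

definition h_order :: "real filter \<Rightarrow> nat \<Rightarrow> (real \<Rightarrow> 'a::real_normed_vector) \<Rightarrow> bool" where
  "h_order F k \<phi> \<longleftrightarrow> (\<exists>C. \<forall>\<^sub>F h in F. norm (\<phi> h) \<le> C * \<bar>h\<bar> ^ k)"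

lemma h_orderE:
  assumes "h_order F k \<phi>"
  obtains C where "0 < C" "\<forall>\<^sub>F h in F. norm (\<phi> h) \<le> C * \<bar>h\<bar> ^ k"
proof -
  obtain C where C: "\<forall>\<^sub>F h in F. norm (\<phi> h) \<le> C * \<bar>h\<bar> ^ k"
    using assms by (auto simp: h_order_def)
  have "\<forall>\<^sub>F h in F. norm (\<phi> h) \<le> (\<bar>C\<bar> + 1) * \<bar>h\<bar> ^ k"
    using C
  proof eventually_elim
    case (elim h)
    have "C * \<bar>h\<bar> ^ k \<le> (\<bar>C\<bar> + 1) * \<bar>h\<bar> ^ k"
      by (intro mult_right_mono) auto
    then show ?case using elim by linarith
  qed
  then show ?thesis using that[of "\<bar>C\<bar> + 1"] by simp
qed

lemma h_order_cong:
  assumes "h_order F k \<phi>" "\<forall>\<^sub>F h in F. \<psi> h = \<phi> h"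
  shows "h_order F k \<psi>"
proof -
  obtain C where C: "\<forall>\<^sub>F h in F. norm (\<phi> h) \<le> C * \<bar>h\<bar> ^ k"
    using assms by (auto simp: h_order_def)
  have "\<forall>\<^sub>F h in F. norm (\<psi> h) \<le> C * \<bar>h\<bar> ^ k"
    using C assms(2) by eventually_elim simp
  then show ?thesis by (auto simp: h_order_def)
qed

lemma h_order_le:
  assumes "h_order F k \<phi>" "\<forall>\<^sub>F h in F. norm (\<psi> h) \<le> B * norm (\<phi> h)"
  shows "h_order F k \<psi>"
proof -
  obtain C where C: "0 < C" "\<forall>\<^sub>F h in F. norm (\<phi> h) \<le> C * \<bar>h\<bar> ^ k"
    using assms(1) by (rule h_orderE)
  have "\<forall>\<^sub>F h in F. norm (\<psi> h) \<le> (\<bar>B\<bar> * C) * \<bar>h\<bar> ^ k"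
    using C(2) assms(2)
  proof eventually_elim
    case (elim h)
    have "norm (\<psi> h) \<le> B * norm (\<phi> h)" by (fact elim)
    also have "\<dots> \<le> \<bar>B\<bar> * norm (\<phi> h)" by (intro mult_right_mono) auto
    also have "\<dots> \<le> \<bar>B\<bar> * (C * \<bar>h\<bar> ^ k)" using elim by (intro mult_left_mono) auto
    finally show ?case by simp
  qed
  then show ?thesis by (auto simp: h_order_def)
qed

lemma h_order_mono:
  assumes "h_order F m \<phi>" "k \<le> m" "F \<le> nhds 0"
  shows "h_order F k \<phi>"
proof -
  obtain C where C: "0 < C" "\<forall>\<^sub>F h in F. norm (\<phi> h) \<le> C * \<bar>h\<bar> ^ m"
    using assms(1) by (rule h_orderE)
  have "\<forall>\<^sub>F h in nhds (0::real). \<bar>h\<bar> < 1"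
    using eventually_nhds_metric[of "\<lambda>h. \<bar>h\<bar> < 1" "0::real"] by (auto intro!: exI[of _ 1])
  then have "\<forall>\<^sub>F h in F. \<bar>h\<bar> < 1" using assms(3) by (simp add: filter_leD)
  with C(2) have "\<forall>\<^sub>F h in F. norm (\<phi> h) \<le> C * \<bar>h\<bar> ^ k"
  proof eventually_elim
    case (elim h)
    have "C * \<bar>h\<bar> ^ m \<le> C * \<bar>h\<bar> ^ k"
      using C(1) elim assms(2) by (intro mult_left_mono power_decreasing) auto
    then show ?case using elim by linarith
  qed
  then show ?thesis by (auto simp: h_order_def)
qed

lemma h_order_add:
  assumes "h_order F k \<phi>" "h_order F k \<psi>"
  shows "h_order F k (\<lambda>h. \<phi> h + \<psi> h)"
proof -
  obtain C where C: "\<forall>\<^sub>F h in F. norm (\<phi> h) \<le> C * \<bar>h\<bar> ^ k"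
    using assms by (auto simp: h_order_def)
  obtain D where D: "\<forall>\<^sub>F h in F. norm (\<psi> h) \<le> D * \<bar>h\<bar> ^ k"
    using assms by (auto simp: h_order_def)
  have "\<forall>\<^sub>F h in F. norm (\<phi> h + \<psi> h) \<le> (C + D) * \<bar>h\<bar> ^ k"
    using C D
  proof eventually_elim
    case (elim h)
    then show ?case using norm_triangle_ineq[of "\<phi> h" "\<psi> h"] by (simp add: distrib_right)
  qed
  then show ?thesis by (auto simp: h_order_def)
qed

lemma h_order_bounded_linear:
  assumes "h_order F k \<phi>" "bounded_linear L"
  shows "h_order F k (\<lambda>h. L (\<phi> h))"
proof -
  obtain K where "\<And>x. norm (L x) \<le> norm x * K"
    using bounded_linear.bounded[OF assms(2)] by blast
  then show ?thesis
    by (intro h_order_le[OF assms(1), of _ K] always_eventually) (simp add: mult.commute)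
qed

lemmas h_order_scaleR = h_order_bounded_linear[OF _ bounded_linear_scaleR_right]
lemmas h_order_component = h_order_bounded_linear[OF _ bounded_linear_vec_nth]

lemma h_order_minus: "h_order F k \<phi> \<Longrightarrow> h_order F k (\<lambda>h. - \<phi> h)"
  by (simp add: h_order_def)

lemma h_order_diff:
  "h_order F k \<phi> \<Longrightarrow> h_order F k \<psi> \<Longrightarrow> h_order F k (\<lambda>h. \<phi> h - \<psi> h)"
  using h_order_add[of F k \<phi> "\<lambda>h. - \<psi> h"] h_order_minus[of F k \<psi>] by simp

lemma h_order_mult:
  fixes u :: "real \<Rightarrow> real"
  assumes "h_order F j u" "h_order F k \<phi>"
  shows "h_order F (j + k) (\<lambda>h. u h *\<^sub>R \<phi> h)"
proof -
  obtain C where C: "0 < C" "\<forall>\<^sub>F h in F. norm (u h) \<le> C * \<bar>h\<bar> ^ j"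
    using assms(1) by (rule h_orderE)
  obtain D where D: "0 < D" "\<forall>\<^sub>F h in F. norm (\<phi> h) \<le> D * \<bar>h\<bar> ^ k"
    using assms(2) by (rule h_orderE)
  have "\<forall>\<^sub>F h in F. norm (u h *\<^sub>R \<phi> h) \<le> (C * D) * \<bar>h\<bar> ^ (j + k)"
    using C(2) D(2)
  proof eventually_elim
    case (elim h)
    have "norm (u h *\<^sub>R \<phi> h) \<le> (C * \<bar>h\<bar> ^ j) * (D * \<bar>h\<bar> ^ k)"
      using mult_mono[OF elim] C(1) by simp
    then show ?case by (simp add: power_add mult_ac)
  qed
  then show ?thesis by (auto simp: h_order_def)
qed

lemma h_order_power: "h_order F k (\<lambda>h. h ^ k :: real)"
  by (auto simp: h_order_def power_abs intro!: exI[of _ 1])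

lemma h_order_const: "h_order F 0 (\<lambda>h. v)"
  by (auto simp: h_order_def intro!: exI[of _ "norm v"])

lemma h_order_zero: "h_order F k (\<lambda>h. 0)"
  by (auto simp: h_order_def intro!: exI[of _ 0])

lemma h_order_monomial: "h_order F k (\<lambda>h. (h ^ k) *\<^sub>R v)"
  using h_order_mult[OF h_order_power h_order_const] by simp

lemma h_order_sum:
  "(\<And>i. i \<in> I \<Longrightarrow> h_order F k (\<phi> i)) \<Longrightarrow> h_order F k (\<lambda>h. \<Sum>i\<in>I. \<phi> i h)"
  by (induction I rule: infinite_finite_induct) (auto intro: h_order_zero h_order_add)

lemma h_order_tendsto_zero:
  assumes "h_order F (Suc k) \<phi>" "F \<le> nhds 0"
  shows "(\<phi> \<longlongrightarrow> 0) F"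
proof -
  obtain C where C: "\<forall>\<^sub>F h in F. norm (\<phi> h) \<le> C * \<bar>h\<bar> ^ Suc k"
    using assms by (auto simp: h_order_def)
  have "((\<lambda>h. h) \<longlongrightarrow> (0::real)) F"
    using assms(2) by (simp add: filterlim_def)
  then have "((\<lambda>h. C * \<bar>h\<bar> ^ Suc k) \<longlongrightarrow> C * \<bar>0\<bar> ^ Suc k) F"
    by (intro tendsto_mult tendsto_const tendsto_power tendsto_rabs)
  then have "((\<lambda>h. C * \<bar>h\<bar> ^ Suc k) \<longlongrightarrow> 0) F"
    by simp
  with C show ?thesis by (rule Lim_null_comparison)
qed

lemma h_order_tendsto:
  assumes "h_order F (Suc k) (\<lambda>h. \<phi> h - a)" "F \<le> nhds 0"
  shows "(\<phi> \<longlongrightarrow> a) F"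
  using h_order_tendsto_zero[OF assms] by (simp add: LIM_zero_iff)

text \<open>The denominator converges to a nonzero limit, so its inverse is O(1) and the quotient
  keeps the order of the numerator.\<close>

lemma h_order_divide:
  fixes u w :: "real \<Rightarrow> real"
  assumes "h_order F k u" "h_order F (Suc j) (\<lambda>h. w h - a)" "a \<noteq> 0" "F \<le> nhds 0"
  shows "h_order F k (\<lambda>h. u h / w h)"
proof -
  have "((\<lambda>h. inverse (w h)) \<longlongrightarrow> inverse a) F"
    using h_order_tendsto[OF assms(2,4)] assms(3) by (rule tendsto_inverse)
  then have "\<forall>\<^sub>F h in F. norm (inverse (w h)) < norm (inverse a) + 1"
    by (intro order_tendstoD(2)[OF tendsto_norm]) auto
  then have "h_order F 0 (\<lambda>h. inverse (w h))"
    by (auto simp: h_order_def intro!: exI[of _ "norm (inverse a) + 1"] elim!: eventually_mono)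
  from h_order_mult[OF this assms(1)] show ?thesis
    by (simp add: field_simps)
qed

lemma positive_orthant_nonzero: "x \<in> positive_orthant \<Longrightarrow> x $ k \<noteq> 0"
  by (metis (mono_tags) mem_Collect_eq order_less_irrefl positive_orthant_def)

section \<open>Linear systems with Patankar weights\<close>

text \<open>The system grouped by donor: the ratio of constituent \<nu> multiplies one vector
  \<open>A \<nu>\<close>, which collects what \<nu> delivers to the others together with its own
  loss.\<close>

definition patankar_vec ::
  "real ^ 'n \<Rightarrow> real \<Rightarrow> ('n \<Rightarrow> real ^ 'n) \<Rightarrow> real ^ 'n \<Rightarrow> real ^ 'n::finite \<Rightarrow> bool" where
  "patankar_vec yn c A w z \<longleftrightarrow> z = yn + c *\<^sub>R (\<Sum>\<nu>\<in>UNIV. (z $ \<nu> / w $ \<nu>) *\<^sub>R A \<nu>)"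

text \<open>All destruction terms of row k carry the ratio of k itself, so they gather in the
  summand \<nu> = k; there the production term is absent because \<open>P k k = 0\<close>.\<close>

lemma patankar_eq_vec:
  assumes "\<And>k. P k k = 0"
    and "\<And>\<nu>. A \<nu> = (\<chi> m. if m = \<nu> then - (\<Sum>j\<in>UNIV. D m j) else P m \<nu>)"
  shows "patankar_eq yn c P D w z \<longleftrightarrow> patankar_vec yn c A w z"
proof -
  have "(\<Sum>\<nu>\<in>UNIV. P k \<nu> * (z $ \<nu> / w $ \<nu>) - D k \<nu> * (z $ k / w $ k))
      = (\<Sum>\<nu>\<in>UNIV. (z $ \<nu> / w $ \<nu>) *\<^sub>R A \<nu>) $ k" for k
  proof -
    have "(\<Sum>\<nu>\<in>UNIV. (z $ \<nu> / w $ \<nu>) *\<^sub>R A \<nu>) $ k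
        = (\<Sum>\<nu>\<in>UNIV. P k \<nu> * (z $ \<nu> / w $ \<nu>)
             - (if \<nu> = k then (\<Sum>j\<in>UNIV. D k j) * (z $ k / w $ k) else 0))"
      unfolding sum_component
      by (intro sum.cong) (auto simp: assms)
    then show ?thesis
      by (simp add: sum_subtractf sum_distrib_right flip: sum_divide_distrib)
  qed
  then show ?thesis
    unfolding patankar_eq_def patankar_vec_def vec_eq_iff by simp
qed

text \<open>The system reads T z = yn with T the identity minus a linear map that shrinks every
  nonzero vector. Such a T is injective, hence bijective in finite dimension, whatever the sign of
  c.\<close>

lemma patankar_vec_unique_solution:
  assumes "\<And>v. v \<noteq> 0 \<Longrightarrow> norm (c *\<^sub>R (\<Sum>\<nu>\<in>UNIV. (v $ \<nu> / w $ \<nu>) *\<^sub>R A \<nu>)) < norm v"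
  shows "\<exists>!z. patankar_vec yn c A w z"
proof -
  define T where "T v = v - c *\<^sub>R (\<Sum>\<nu>\<in>UNIV. (v $ \<nu> / w $ \<nu>) *\<^sub>R A \<nu>)" for v
  have lin: "linear T"
    unfolding T_def
    by (intro linearI) (simp_all add: algebra_simps add_divide_distrib sum.distrib scaleR_sum_right)
  have "T v \<noteq> 0" if "v \<noteq> 0" for v
    using assms[OF that] unfolding T_def by (metis eq_iff_diff_eq_0 order_less_irrefl)
  then have inj: "inj T"
    using linear_injective_0[OF lin] by blast
  then have "surj T"
    using linear_injective_imp_surjective[OF lin] by simp
  then obtain z where "T z = yn" by (metis surjD)
  moreover have "patankar_vec yn c A w z \<longleftrightarrow> T z = yn" for z
    by (auto simp: patankar_vec_def T_def algebra_simps)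
  ultimately show ?thesis using inj by (metis injD)
qed

lemma patankar_vec_solution:
  fixes yn :: "real ^ 'n::finite"
  assumes F: "F \<le> nhds 0" and yn: "yn \<in> positive_orthant"
    and A: "\<And>\<nu>. h_order F 0 (\<lambda>h. A h \<nu>)"
    and w: "h_order F 1 (\<lambda>h. w h - yn)"
  obtains Z where "\<forall>\<^sub>F h in F. \<forall>z. patankar_vec yn (\<kappa> * h) (A h) (w h) z \<longleftrightarrow> z = Z h"
    and "h_order F 1 (\<lambda>h. Z h - yn)"
proof -
  \<comment> \<open>Up to the factor \<open>\<kappa> * h\<close>, this bounds the operator norm of
    the map that the system subtracts from the identity.\<close>
  define B where "B h = (\<Sum>\<nu>\<in>UNIV. norm (A h \<nu>) / \<bar>w h $ \<nu>\<bar>)" for h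
  have "h_order F 0 B"
    unfolding B_def
  proof (intro h_order_sum)
    fix \<nu>
    have 1: "h_order F 0 (\<lambda>h. norm (A h \<nu>))"
      using A[of \<nu>] by (simp add: h_order_def)
    have 2: "h_order F (Suc 0) (\<lambda>h. w h $ \<nu> - yn $ \<nu>)"
      using h_order_component[OF w, of \<nu>] by simp
    have "h_order F 0 (\<lambda>h. norm (A h \<nu>) / w h $ \<nu>)"
      using yn by (intro h_order_divide[OF 1 2 _ F]) (auto simp: positive_orthant_nonzero)
    then show "h_order F 0 (\<lambda>h. norm (A h \<nu>) / \<bar>w h $ \<nu>\<bar>)"
      by (simp add: h_order_def)
  qed
  then have ordB: "h_order F 1 (\<lambda>h. (\<kappa> * h) *\<^sub>R B h)"
    using h_order_scaleR[OF h_order_mult[OF h_order_power[of F 1]], of 0 B \<kappa>] by (simp add: mult.assoc)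
  then have "((\<lambda>h. norm ((\<kappa> * h) *\<^sub>R B h)) \<longlongrightarrow> 0) F"
    using h_order_tendsto_zero[of F 0, OF _ F] tendsto_norm_zero by fastforce
  \<comment> \<open>A bound below 1 gives solvability; the value 1/2 also yields
    \<open>norm (Z h) \<le> 2 * norm yn\<close>, which turns the equation into an O(h) bound for
    \<open>Z h - yn\<close>.\<close>
  then have half: "\<forall>\<^sub>F h in F. norm ((\<kappa> * h) *\<^sub>R B h) < 1 / 2"
    by (rule order_tendstoD) simp
  have bound: "norm ((\<kappa> * h) *\<^sub>R (\<Sum>\<nu>\<in>UNIV. (v $ \<nu> / w h $ \<nu>) *\<^sub>R A h \<nu>)) \<le> norm ((\<kappa> * h) *\<^sub>R B h) * norm v"
    for h v
  proof -
    have "norm (\<Sum>\<nu>\<in>UNIV. (v $ \<nu> / w h $ \<nu>) *\<^sub>R A h \<nu>) \<le> (\<Sum>\<nu>\<in>UNIV. norm v * (norm (A h \<nu>) / \<bar>w h $ \<nu>\<bar>))"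
    proof (intro sum_norm_le)
      fix \<nu> 
      have "norm ((v $ \<nu> / w h $ \<nu>) *\<^sub>R A h \<nu>) = \<bar>v $ \<nu>\<bar> * (norm (A h \<nu>) / \<bar>w h $ \<nu>\<bar>)" by simp
      also have "\<dots> \<le> norm v * (norm (A h \<nu>) / \<bar>w h $ \<nu>\<bar>)"
        by (intro mult_right_mono) (auto simp: component_le_norm_cart)
      finally show "norm ((v $ \<nu> / w h $ \<nu>) *\<^sub>R A h \<nu>) \<le> norm v * (norm (A h \<nu>) / \<bar>w h $ \<nu>\<bar>)" .
    qed
    also have "\<dots> = norm v * B h" by (simp add: B_def sum_distrib_left)
    finally have *: "norm (\<Sum>\<nu>\<in>UNIV. (v $ \<nu> / w h $ \<nu>) *\<^sub>R A h \<nu>) \<le> norm v * B h" .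
    have "0 \<le> B h" by (simp add: B_def sum_nonneg)
    then show ?thesis using mult_left_mono[OF *, of "\<bar>\<kappa> * h\<bar>"]
      by (simp add: abs_mult mult_ac)
  qed
  define Z where "Z h = (THE z. patankar_vec yn (\<kappa> * h) (A h) (w h) z)" for h
  have unique: "\<forall>\<^sub>F h in F. \<forall>z. patankar_vec yn (\<kappa> * h) (A h) (w h) z \<longleftrightarrow> z = Z h"
    using half
  proof eventually_elim
    case (elim h)
    have "\<exists>!z. patankar_vec yn (\<kappa> * h) (A h) (w h) z"
    proof (rule patankar_vec_unique_solution)
      fix v :: "real ^ 'n" assume "v \<noteq> 0"
      then have "norm ((\<kappa> * h) *\<^sub>R B h) * norm v < 1 * norm v"
        using elim by (intro mult_strict_right_mono) auto
      then show "norm ((\<kappa> * h) *\<^sub>R (\<Sum>\<nu>\<in>UNIV. (v $ \<nu> / w h $ \<nu>) *\<^sub>R A h \<nu>)) < norm v"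
        using bound[of h v] by linarith
    qed
    from theI'[OF this] this show ?case unfolding Z_def by blast
  qed
  have "\<forall>\<^sub>F h in F. norm (Z h - yn) \<le> (2 * norm yn) * norm ((\<kappa> * h) *\<^sub>R B h)"
    using unique half
  proof eventually_elim
    case (elim h)
    have eq: "Z h = yn + (\<kappa> * h) *\<^sub>R (\<Sum>\<nu>\<in>UNIV. (Z h $ \<nu> / w h $ \<nu>) *\<^sub>R A h \<nu>)"
      using elim(1) unfolding patankar_vec_def by blast
    then have le: "norm (Z h - yn) \<le> norm ((\<kappa> * h) *\<^sub>R B h) * norm (Z h)"
      using bound[of h "Z h"] by (metis add_diff_cancel_left')
    also have "\<dots> \<le> 1 / 2 * norm (Z h)"
      using elim(2) by (intro mult_right_mono) auto
    finally have "norm (Z h) \<le> 2 * norm yn"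
      using norm_triangle_sub[of "Z h" yn] by linarith
    then have "norm ((\<kappa> * h) *\<^sub>R B h) * norm (Z h) \<le> norm ((\<kappa> * h) *\<^sub>R B h) * (2 * norm yn)"
      by (intro mult_left_mono) auto
    then show ?case using le by (simp add: mult.commute)
  qed
  then have "h_order F 1 (\<lambda>h. Z h - yn)"
    by (rule h_order_le[OF ordB])
  with unique show ?thesis using that by blast
qed

text \<open>An exact identity, from z/w - 1 = (z - w)/w in each component. Both order estimates for
  stages start from it.\<close>

lemma patankar_vec_defect:
  assumes "patankar_vec yn c A w z" "\<And>\<nu>. w $ \<nu> \<noteq> 0"
  shows "z - (yn + c *\<^sub>R (\<Sum>\<nu>\<in>UNIV. A \<nu>)) = c *\<^sub>R (\<Sum>\<nu>\<in>UNIV. ((z - w) $ \<nu> / w $ \<nu>) *\<^sub>R A \<nu>)"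
proof -
  have "(\<Sum>\<nu>\<in>UNIV. ((z - w) $ \<nu> / w $ \<nu>) *\<^sub>R A \<nu>)
      = (\<Sum>\<nu>\<in>UNIV. (z $ \<nu> / w $ \<nu>) *\<^sub>R A \<nu> - A \<nu>)"
    using assms(2) by (intro sum.cong) (auto simp: diff_divide_distrib scaleR_left_diff_distrib)
  moreover have "z = yn + c *\<^sub>R (\<Sum>\<nu>\<in>UNIV. (z $ \<nu> / w $ \<nu>) *\<^sub>R A \<nu>)"
    using assms(1) by (simp only: patankar_vec_def)
  from arg_cong[OF this, of "\<lambda>x. x - (yn + c *\<^sub>R sum A UNIV)"]
  have "z - (yn + c *\<^sub>R sum A UNIV) = c *\<^sub>R ((\<Sum>\<nu>\<in>UNIV. (z $ \<nu> / w $ \<nu>) *\<^sub>R A \<nu>) - sum A UNIV)"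
    by (simp only: scaleR_right_diff_distrib add_diff_cancel_left)
  ultimately show ?thesis
    by (simp only: sum_subtractf)
qed

lemma eventually_positive_orthant:
  fixes yn :: "real ^ 'n::finite"
  assumes F: "F \<le> nhds 0" and yn: "yn \<in> positive_orthant" and w: "h_order F 1 (\<lambda>h. w h - yn)"
  shows "\<forall>\<^sub>F h in F. w h \<in> positive_orthant"
proof -
  have "(w \<longlongrightarrow> yn) F" using w F by (intro h_order_tendsto[of _ 0]) auto
  then have "\<forall>\<^sub>F h in F. 0 < w h $ \<nu>" for \<nu>
    using yn by (intro order_tendstoD(1)[OF tendsto_vec_nth]) (auto simp: positive_orthant_def)
  then show ?thesis by (simp add: positive_orthant_def eventually_all_finite)
qed

lemma patankar_vec_order:
  fixes yn :: "real ^ 'n::finite"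
  assumes F: "F \<le> nhds 0" and yn: "yn \<in> positive_orthant"
    and A: "\<And>\<nu>. h_order F 0 (\<lambda>h. A h \<nu>)"
    and w: "h_order F 1 (\<lambda>h. w h - yn)"
    and Z: "\<forall>\<^sub>F h in F. patankar_vec yn (\<kappa> * h) (A h) (w h) (Z h)"
    and Zw: "h_order F k (\<lambda>h. Z h - w h)"
  shows "h_order F (Suc k) (\<lambda>h. Z h - (yn + (\<kappa> * h) *\<^sub>R (\<Sum>\<nu>\<in>UNIV. A h \<nu>)))"
proof -
  have "h_order F k (\<lambda>h. (Z h - w h) $ \<nu> / w h $ \<nu>)" for \<nu>
    using yn h_order_component[OF w, of \<nu>] h_order_component[OF Zw, of \<nu>]
    by (intro h_order_divide[OF _ _ _ F, of k _ 0 _ "yn $ \<nu>"]) (auto simp: positive_orthant_nonzero)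
  from h_order_mult[OF this A]
  have "h_order F k (\<lambda>h. \<Sum>\<nu>\<in>UNIV. ((Z h - w h) $ \<nu> / w h $ \<nu>) *\<^sub>R A h \<nu>)"
    by (intro h_order_sum) simp
  from h_order_scaleR[OF h_order_mult[OF h_order_power[of F 1] this], of \<kappa>]
  have *: "h_order F (Suc k) (\<lambda>h. (\<kappa> * h) *\<^sub>R (\<Sum>\<nu>\<in>UNIV. ((Z h - w h) $ \<nu> / w h $ \<nu>) *\<^sub>R A h \<nu>))"
    by simp
  show ?thesis
    using eventually_positive_orthant[OF F yn w] Z
    by (intro h_order_cong[OF *], eventually_elim)
      (intro patankar_vec_defect, auto simp: positive_orthant_nonzero)
qed

text \<open>In the defect, \<open>w\<close> is frozen at \<open>yn\<close> and \<open>A\<close> at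
  \<open>A0\<close>. Since v/w = v/yn - (v/yn) (w - yn)/w, the error in each summand splits into
  three pieces: the remainder of \<open>Z - w\<close>, the change of the denominator, and the change
  of \<open>A\<close>. Each is O(h^(k+1)), and the outer factor \<kappa> h adds one more
  power.\<close>

lemma patankar_vec_order_leading:
  fixes yn v :: "real ^ 'n::finite"
  assumes F: "F \<le> nhds 0" and yn: "yn \<in> positive_orthant"
    and A: "\<And>\<nu>. h_order F 1 (\<lambda>h. A h \<nu> - A0 \<nu>)"
    and w: "h_order F 1 (\<lambda>h. w h - yn)"
    and Z: "\<forall>\<^sub>F h in F. patankar_vec yn (\<kappa> * h) (A h) (w h) (Z h)"
    and Zw: "h_order F (Suc k) (\<lambda>h. Z h - w h - (h ^ k) *\<^sub>R v)"
  shows "h_order F (Suc (Suc k)) (\<lambda>h. Z h - (yn + (\<kappa> * h) *\<^sub>R (\<Sum>\<nu>\<in>UNIV. A h \<nu>))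
    - (h ^ Suc k) *\<^sub>R (\<kappa> *\<^sub>R (\<Sum>\<nu>\<in>UNIV. (v $ \<nu> / yn $ \<nu>) *\<^sub>R A0 \<nu>)))"
proof -
  have ne: "yn $ \<nu> \<noteq> 0" for \<nu> using yn by (rule positive_orthant_nonzero)
  have summand: "h_order F (Suc k)
      (\<lambda>h. ((Z h - w h) $ \<nu> / w h $ \<nu>) *\<^sub>R A h \<nu> - (h ^ k * (v $ \<nu> / yn $ \<nu>)) *\<^sub>R A0 \<nu>)" for \<nu>
  proof -
    have 1: "h_order F (Suc k) (\<lambda>h. (Z h - w h - (h ^ k) *\<^sub>R v) $ \<nu> / w h $ \<nu>)"
      using ne h_order_component[OF w, of \<nu>] h_order_component[OF Zw, of \<nu>]
      by (intro h_order_divide[OF _ _ _ F, of _ _ 0 _ "yn $ \<nu>"]) auto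
    have A': "h_order F 0 (\<lambda>h. A h \<nu>)"
      using h_order_add[OF h_order_mono[OF A[of \<nu>] _ F, of 0] h_order_const[of F "A0 \<nu>"]] by simp
    note h_order_mult[OF 1 A']
    moreover
    have "h_order F 1 (\<lambda>h. (w h - yn) $ \<nu> / w h $ \<nu>)"
      using ne h_order_component[OF w, of \<nu>]
      by (intro h_order_divide[OF _ _ _ F, of _ _ 0 _ "yn $ \<nu>"]) auto
    from h_order_mult[OF h_order_power[of F k] h_order_mult[OF this A']]
    have "h_order F (Suc k) (\<lambda>h. h ^ k *\<^sub>R ((w h - yn) $ \<nu> / w h $ \<nu>) *\<^sub>R A h \<nu>)"
      by simp
    note h_order_scaleR[OF this, of "v $ \<nu> / yn $ \<nu>"]
    moreover
    have "h_order F (Suc k) (\<lambda>h. h ^ k *\<^sub>R (A h \<nu> - A0 \<nu>))"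
      using h_order_mult[OF h_order_power[of F k] A] by simp
    note h_order_scaleR[OF this, of "v $ \<nu> / yn $ \<nu>"]
    ultimately have "h_order F (Suc k) (\<lambda>h. ((Z h - w h - (h ^ k) *\<^sub>R v) $ \<nu> / w h $ \<nu>) *\<^sub>R A h \<nu>
       - (v $ \<nu> / yn $ \<nu>) *\<^sub>R h ^ k *\<^sub>R ((w h - yn) $ \<nu> / w h $ \<nu>) *\<^sub>R A h \<nu>
       + (v $ \<nu> / yn $ \<nu>) *\<^sub>R h ^ k *\<^sub>R (A h \<nu> - A0 \<nu>))"
      by (auto intro!: h_order_add h_order_diff)
    then show ?thesis
    proof (rule h_order_cong)
      show "\<forall>\<^sub>F h in F. ((Z h - w h) $ \<nu> / w h $ \<nu>) *\<^sub>R A h \<nu> - (h ^ k * (v $ \<nu> / yn $ \<nu>)) *\<^sub>R A0 \<nu>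
         = ((Z h - w h - (h ^ k) *\<^sub>R v) $ \<nu> / w h $ \<nu>) *\<^sub>R A h \<nu>
           - (v $ \<nu> / yn $ \<nu>) *\<^sub>R h ^ k *\<^sub>R ((w h - yn) $ \<nu> / w h $ \<nu>) *\<^sub>R A h \<nu>
           + (v $ \<nu> / yn $ \<nu>) *\<^sub>R h ^ k *\<^sub>R (A h \<nu> - A0 \<nu>)"
        using eventually_positive_orthant[OF F yn w]
      proof eventually_elim
        case (elim h)
        then have "w h $ \<nu> \<noteq> 0" by (simp add: positive_orthant_nonzero)
        then have "(Z h - w h) $ \<nu> / w h $ \<nu> = (Z h - w h - (h ^ k) *\<^sub>R v) $ \<nu> / w h $ \<nu>
             - (v $ \<nu> / yn $ \<nu>) * h ^ k * ((w h - yn) $ \<nu> / w h $ \<nu>) + (v $ \<nu> / yn $ \<nu>) * h ^ k"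
          using ne[of \<nu>] by (simp add: field_simps)
        moreover have "(b - q * g * e + q * g) *\<^sub>R x - (g * q) *\<^sub>R x0
            = b *\<^sub>R x - q *\<^sub>R g *\<^sub>R e *\<^sub>R x + q *\<^sub>R g *\<^sub>R (x - x0)"
          for b q g e and x x0 :: "real ^ 'n"
          by (simp add: algebra_simps)
        ultimately show ?case by (simp only:)
      qed
    qed
  qed
  have "h_order F (Suc k)
      (\<lambda>h. \<Sum>\<nu>\<in>UNIV. ((Z h - w h) $ \<nu> / w h $ \<nu>) *\<^sub>R A h \<nu> - (h ^ k * (v $ \<nu> / yn $ \<nu>)) *\<^sub>R A0 \<nu>)"
    by (intro h_order_sum summand)
  note * = h_order_scaleR[OF h_order_mult[OF h_order_power[of F 1] this], of \<kappa>]
  show ?thesis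
  proof (rule h_order_cong)
    show "h_order F (Suc (Suc k)) (\<lambda>h. (\<kappa> * h) *\<^sub>R (\<Sum>\<nu>\<in>UNIV. ((Z h - w h) $ \<nu> / w h $ \<nu>) *\<^sub>R A h \<nu>
         - (h ^ k * (v $ \<nu> / yn $ \<nu>)) *\<^sub>R A0 \<nu>))"
      using * by simp
    show "\<forall>\<^sub>F h in F. Z h - (yn + (\<kappa> * h) *\<^sub>R (\<Sum>\<nu>\<in>UNIV. A h \<nu>))
        - (h ^ Suc k) *\<^sub>R (\<kappa> *\<^sub>R (\<Sum>\<nu>\<in>UNIV. (v $ \<nu> / yn $ \<nu>) *\<^sub>R A0 \<nu>))
      = (\<kappa> * h) *\<^sub>R (\<Sum>\<nu>\<in>UNIV. ((Z h - w h) $ \<nu> / w h $ \<nu>) *\<^sub>R A h \<nu>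
         - (h ^ k * (v $ \<nu> / yn $ \<nu>)) *\<^sub>R A0 \<nu>)"
      using eventually_positive_orthant[OF F yn w] Z
    proof eventually_elim
      case (elim h)
      then have "\<And>\<nu>. w h $ \<nu> \<noteq> 0" by (simp add: positive_orthant_nonzero)
      from patankar_vec_defect[OF elim(2) this] show ?case
        by (simp add: sum_subtractf scaleR_sum_right algebra_simps)
    qed
  qed
qed

section \<open>Functions of class C^k\<close>

lemma Ck_on_SucD:
  assumes "Ck_on (Suc k) S f" "x \<in> S"
  shows "(f has_derivative frechet_derivative f (at x)) (at x)"
  using assms by (simp add: frechet_derivative_works)

lemma Ck_on_cong:
  assumes "open S" "\<And>x. x \<in> S \<Longrightarrow> f x = g x" "Ck_on k S f"
  shows "Ck_on k S g"
  using assms(2,3)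
proof (induction k arbitrary: f g)
  case 0
  then show ?case by (simp cong: continuous_on_cong)
next
  case (Suc k)
  have D: "(g has_derivative frechet_derivative f (at x)) (at x)" if "x \<in> S" for x
    using Ck_on_SucD[OF Suc.prems(2) that] assms(1) that
    by (rule has_derivative_transform_within_open) (simp add: Suc.prems(1))
  have "Ck_on k S (\<lambda>x. frechet_derivative g (at x) v)" for v
    by (rule Suc.IH[of "\<lambda>x. frechet_derivative f (at x) v"])
      (use Suc.prems(2) frechet_derivative_at[OF D] in auto)
  then show ?case using D by (auto simp: differentiable_def)
qed

text \<open>Allows any explicit derivative in place of the one chosen by
  \<open>frechet_derivative\<close>; the closure properties that follow use it with the usual
  differentiation rules.\<close>

lemma Ck_on_SucI:
  assumes "open S" "\<And>x. x \<in> S \<Longrightarrow> (f has_derivative D x) (at x)" "\<And>v. Ck_on k S (\<lambda>x. D x v)"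
  shows "Ck_on (Suc k) S f"
proof -
  have "Ck_on k S (\<lambda>x. frechet_derivative f (at x) v)" for v
    by (rule Ck_on_cong[OF assms(1) _ assms(3)[of v]]) (metis assms(2) frechet_derivative_at)
  then show ?thesis using assms(2) by (auto simp: differentiable_def)
qed

lemma Ck_on_Suc_imp: "Ck_on (Suc k) S f \<Longrightarrow> Ck_on k S f"
proof (induction k arbitrary: f)
  case 0
  then show ?case
    by (auto simp: intro!: continuous_at_imp_continuous_on differentiable_imp_continuous_within)
next
  case (Suc k)
  then show ?case by (metis Ck_on.simps(2))
qed

lemma Ck_on_mono: "Ck_on m S f \<Longrightarrow> k \<le> m \<Longrightarrow> Ck_on k S f"
  by (induction m) (auto simp: le_Suc_eq simp del: Ck_on.simps dest: Ck_on_Suc_imp)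

lemma Ck_on_zero: "Ck_on k S (\<lambda>x. 0)"
  by (induction k) auto

lemma Ck_on_add:
  assumes "open S" "Ck_on k S f" "Ck_on k S g"
  shows "Ck_on k S (\<lambda>x. f x + g x)"
  using assms(2,3)
proof (induction k arbitrary: f g)
  case 0
  then show ?case by (auto intro: continuous_intros)
next
  case (Suc k)
  show ?case
    using Suc by (intro Ck_on_SucI[OF assms(1) has_derivative_add[OF Ck_on_SucD Ck_on_SucD]]) auto
qed

lemma Ck_on_sum:
  assumes "open S" "\<And>i. i \<in> I \<Longrightarrow> Ck_on k S (f i)"
  shows "Ck_on k S (\<lambda>x. \<Sum>i\<in>I. f i x)"
  using assms(2)
  by (induction I rule: infinite_finite_induct) (auto intro: Ck_on_zero Ck_on_add[OF assms(1)])

lemma Ck_on_bounded_linear: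
  assumes "open S" "bounded_linear L" "Ck_on k S f"
  shows "Ck_on k S (\<lambda>x. L (f x))"
  using assms(3)
proof (induction k arbitrary: f)
  case 0
  then show ?case by (auto intro: bounded_linear.continuous_on[OF assms(2)])
next
  case (Suc k)
  show ?case
    using Suc
    by (intro Ck_on_SucI[OF assms(1) bounded_linear.has_derivative[OF assms(2) Ck_on_SucD]]) auto
qed

lemma Ck_on_scaleR:
  assumes "open S" "Ck_on k S u" "Ck_on k S f"
  shows "Ck_on k S (\<lambda>x. u x *\<^sub>R f x)"
  using assms(2,3)
proof (induction k arbitrary: u f)
  case 0
  then show ?case by (auto intro: continuous_intros)
next
  case (Suc k)
  show ?case
  proof (rule Ck_on_SucI[OF assms(1) has_derivative_scaleR[OF Ck_on_SucD Ck_on_SucD]])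
    fix v
    show "Ck_on k S (\<lambda>x. u x *\<^sub>R frechet_derivative f (at x) v + frechet_derivative u (at x) v *\<^sub>R f x)"
      using Suc Ck_on_Suc_imp[OF Suc.prems(1)] Ck_on_Suc_imp[OF Suc.prems(2)]
      by (intro Ck_on_add assms(1)) auto
  qed (use Suc.prems in auto)
qed

text \<open>Along a solution of y' = f(y) the chain rule gives the derivative of \<phi>(y) as
  \<open>lie_derivative f \<phi>\<close> evaluated at y; iterating from \<open>f\<close> produces
  all higher derivatives of the solution.\<close>

definition lie_derivative ::
  "('a::real_normed_vector \<Rightarrow> 'a) \<Rightarrow> ('a \<Rightarrow> 'b::real_normed_vector) \<Rightarrow> 'a \<Rightarrow> 'b" where
  "lie_derivative f \<phi> x = frechet_derivative \<phi> (at x) (f x)"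

text \<open>\<open>Ck_on\<close> controls derivatives in fixed directions, whereas here the
  direction f(x) varies with x. Expanding it in the basis leaves fixed directions with smooth scalar
  coefficients.\<close>

lemma Ck_on_lie_derivative:
  fixes f :: "'a::euclidean_space \<Rightarrow> 'a"
  assumes "open S" "Ck_on k S f" "Ck_on (Suc k) S \<phi>"
  shows "Ck_on k S (lie_derivative f \<phi>)"
proof (rule Ck_on_cong[OF assms(1)])
  show "Ck_on k S (\<lambda>x. \<Sum>b\<in>Basis. (f x \<bullet> b) *\<^sub>R frechet_derivative \<phi> (at x) b)"
    using assms
    by (intro Ck_on_sum Ck_on_scaleR Ck_on_bounded_linear[OF _ bounded_linear_inner_left]) auto
  fix x assume "x \<in> S"
  then have "linear (frechet_derivative \<phi> (at x))"
    using assms(3) by (auto intro: linear_frechet_derivative)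
  then show "(\<Sum>b\<in>Basis. (f x \<bullet> b) *\<^sub>R frechet_derivative \<phi> (at x) b) = lie_derivative f \<phi> x"
    unfolding lie_derivative_def
    by (subst (3) euclidean_representation[symmetric]) (simp add: linear_sum linear_scale)
qed

lemma Ck_on_lie_derivative_iterate:
  fixes f :: "'a::euclidean_space \<Rightarrow> 'a"
  assumes "open S" "Ck_on n S f" "i \<le> n"
  shows "Ck_on (n - i) S ((lie_derivative f ^^ i) f)"
  using assms(3)
proof (induction i)
  case 0
  then show ?case using assms(2) by simp
next
  case (Suc i)
  then have "Ck_on (Suc (n - Suc i)) S ((lie_derivative f ^^ i) f)"
    by (simp add: Suc_diff_Suc del: Ck_on.simps)
  then show ?case
    using assms(1,2) by (auto intro!: Ck_on_lie_derivative Ck_on_mono[OF assms(2)] simp del: Ck_on.simps)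
qed

text \<open>On a compact ball the derivative in each basis direction is bounded; the sum of these
  bounds dominates the operator norm, and the mean value inequality applies because the ball is
  convex.\<close>

lemma Ck_on_locally_Lipschitz:
  fixes \<phi> :: "'a::euclidean_space \<Rightarrow> 'b::real_normed_vector"
  assumes "open S" "Ck_on (Suc 0) S \<phi>" "x0 \<in> S"
  obtains r B where "0 < r" "0 \<le> B" "cball x0 r \<subseteq> S"
    "\<And>x x'. x \<in> cball x0 r \<Longrightarrow> x' \<in> cball x0 r \<Longrightarrow> norm (\<phi> x - \<phi> x') \<le> B * norm (x - x')"
proof -
  obtain r where r: "0 < r" "cball x0 r \<subseteq> S"
    using assms(1,3) by (auto simp: open_contains_cball)
  have "\<exists>C. \<forall>x\<in>cball x0 r. norm (frechet_derivative \<phi> (at x) b) \<le> C" for b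
  proof -
    have "continuous_on (cball x0 r) (\<lambda>x. frechet_derivative \<phi> (at x) b)"
      using assms(2) r(2) by (auto intro: continuous_on_subset)
    then have "bounded ((\<lambda>x. frechet_derivative \<phi> (at x) b) ` cball x0 r)"
      by (intro compact_imp_bounded compact_continuous_image) auto
    then show ?thesis by (auto simp: bounded_iff)
  qed
  then obtain C where C: "\<And>b x. x \<in> cball x0 r \<Longrightarrow> norm (frechet_derivative \<phi> (at x) b) \<le> C b"
    by metis
  define B where "B = (\<Sum>b\<in>Basis. \<bar>C b\<bar>)"
  have D: "(\<phi> has_derivative frechet_derivative \<phi> (at x)) (at x)" if "x \<in> cball x0 r" for x
    using Ck_on_SucD[OF assms(2)] that r(2) by blast
  have onorm: "onorm (frechet_derivative \<phi> (at x)) \<le> B" if "x \<in> cball x0 r" for x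
  proof -
    have "onorm (frechet_derivative \<phi> (at x)) \<le> (\<Sum>b\<in>Basis. norm (frechet_derivative \<phi> (at x) b))"
      by (intro onorm_componentwise has_derivative_bounded_linear[OF D[OF that]])
    also have "\<dots> \<le> B"
      unfolding B_def using C[OF that] by (intro sum_mono) (meson abs_ge_self order_trans)
    finally show ?thesis .
  qed
  show ?thesis
  proof (rule that[OF r(1) _ r(2)])
    show "0 \<le> B" by (simp add: B_def sum_nonneg)
    fix x x' assume "x \<in> cball x0 r" "x' \<in> cball x0 r"
    then show "norm (\<phi> x - \<phi> x') \<le> B * norm (x - x')"
      using has_derivative_at_withinI[OF D] onorm
      by (intro differentiable_bound[of "cball x0 r" _ "\<lambda>x. frechet_derivative \<phi> (at x)"]) auto
  qed
qed

text \<open>The local Lipschitz bound is applied to the derivative in each basis direction, on the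
  smallest of the resulting balls. In the second estimate the base point c need not lie between a
  and b: the derivative may be frozen at the start of the step although both arguments lie
  elsewhere.\<close>

lemma Ck_on_derivative_locally_Lipschitz:
  fixes f :: "'a::euclidean_space \<Rightarrow> 'b::real_normed_vector"
  assumes S: "open S" and f: "Ck_on (Suc (Suc 0)) S f" and x0: "x0 \<in> S"
  obtains r B where "0 < r" "0 \<le> B" "cball x0 r \<subseteq> S"
    "\<And>x c v. x \<in> cball x0 r \<Longrightarrow> c \<in> cball x0 r \<Longrightarrow>
      norm (frechet_derivative f (at x) v - frechet_derivative f (at c) v) \<le> B * norm (x - c) * norm v"
    "\<And>a b c. a \<in> cball x0 r \<Longrightarrow> b \<in> cball x0 r \<Longrightarrow> c \<in> cball x0 r \<Longrightarrow>
      norm (f b - f a - frechet_derivative f (at c) (b - a))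
        \<le> B * (norm (a - c) + norm (b - c)) * norm (b - a)"
proof -
  define D where "D x = frechet_derivative f (at x)" for x
  have "\<exists>r B. 0 < r \<and> 0 \<le> B \<and> cball x0 r \<subseteq> S \<and>
     (\<forall>x\<in>cball x0 r. \<forall>x'\<in>cball x0 r. norm (D x b - D x' b) \<le> B * norm (x - x'))" for b
  proof -
    have "Ck_on (Suc 0) S (\<lambda>x. D x b)" using f by (auto simp: D_def)
    from Ck_on_locally_Lipschitz[OF S this x0] show ?thesis by metis
  qed
  then obtain R C where RC: "\<And>b. 0 < R b" "\<And>b. 0 \<le> C b" "\<And>b. cball x0 (R b) \<subseteq> S"
    "\<And>b x x'. x \<in> cball x0 (R b) \<Longrightarrow> x' \<in> cball x0 (R b) \<Longrightarrow> norm (D x b - D x' b) \<le> C b * norm (x - x')"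
    by metis
  define r where "r = Min (R ` Basis)"
  define B where "B = (\<Sum>b\<in>Basis. C b)"
  have r: "0 < r" using RC(1) by (auto simp: r_def)
  have rR: "cball x0 r \<subseteq> cball x0 (R b)" if "b \<in> Basis" for b
    using that by (intro subset_cball) (auto simp: r_def)
  have rS: "cball x0 r \<subseteq> S"
    using rR RC(3) SOME_Basis by blast
  have B: "0 \<le> B" using RC(2) by (auto simp: B_def intro: sum_nonneg)
  have der: "(f has_derivative D x) (at x)" if "x \<in> cball x0 r" for x
    using Ck_on_SucD[OF f] that rS by (auto simp: D_def)
  have bl: "bounded_linear (\<lambda>v. D x v - D c v)" if "x \<in> cball x0 r" "c \<in> cball x0 r" for x c
    using that by (intro bounded_linear_sub has_derivative_bounded_linear[OF der])
  have onormD: "onorm (\<lambda>v. D x v - D c v) \<le> B * norm (x - c)" if "x \<in> cball x0 r" "c \<in> cball x0 r" for x c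
  proof -
    have "onorm (\<lambda>v. D x v - D c v) \<le> (\<Sum>b\<in>Basis. norm (D x b - D c b))"
      by (intro onorm_componentwise bl that)
    also have "\<dots> \<le> (\<Sum>b\<in>Basis. C b * norm (x - c))"
      using that rR by (intro sum_mono RC(4)) blast+
    finally show ?thesis by (simp add: B_def sum_distrib_right)
  qed
  show ?thesis
  proof (rule that[OF r B rS])
    fix x c v assume xc: "x \<in> cball x0 r" "c \<in> cball x0 r"
    have "norm (D x v - D c v) \<le> onorm (\<lambda>v. D x v - D c v) * norm v"
      by (rule onorm[OF bl[OF xc]])
    also have "\<dots> \<le> B * norm (x - c) * norm v"
      by (intro mult_right_mono onormD xc) auto
    finally show "norm (frechet_derivative f (at x) v - frechet_derivative f (at c) v) \<le> B * norm (x - c) * norm v"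
      by (simp add: D_def)
  next
    fix a b c assume abc: "a \<in> cball x0 r" "b \<in> cball x0 r" "c \<in> cball x0 r"
    \<comment> \<open>Both endpoints lie in the ball of radius m about c, hence so does the segment;
      the mean value inequality for f minus its linearization at c then has the constant B
      m.\<close>
    define m where "m = norm (a - c) + norm (b - c)"
    have seg: "closed_segment a b \<subseteq> cball x0 r"
      using abc by (intro closed_segment_subset) auto
    have segm: "closed_segment a b \<subseteq> cball c m"
      by (intro closed_segment_subset) (auto simp: m_def dist_norm norm_minus_commute)
    have "norm ((f b - D c b) - (f a - D c a)) \<le> (B * m) * norm (b - a)"
    proof (rule differentiable_bound[of "closed_segment a b"])
      fix x assume x: "x \<in> closed_segment a b"
      then have xr: "x \<in> cball x0 r" using seg by blast
      show "((\<lambda>x. f x - D c x) has_derivative (\<lambda>v. D x v - D c v)) (at x within closed_segment a b)"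
        by (rule has_derivative_at_withinI[OF has_derivative_diff[OF der[OF xr]
          bounded_linear_imp_has_derivative[OF has_derivative_bounded_linear[OF der[OF abc(3)]]]]])
      have "norm (x - c) \<le> m" using segm x by (auto simp: dist_norm norm_minus_commute)
      then show "onorm (\<lambda>v. D x v - D c v) \<le> B * m"
        using onormD[OF xr abc(3)] mult_left_mono[of _ m B] B by fastforce
    qed auto
    moreover have "D c b - D c a = D c (b - a)"
      by (rule linear_diff[symmetric, OF bounded_linear.linear[OF has_derivative_bounded_linear[OF der[OF abc(3)]]]])
    then have "(f b - D c b) - (f a - D c a) = f b - f a - D c (b - a)"
      by (simp add: algebra_simps)
    ultimately show "norm (f b - f a - frechet_derivative f (at c) (b - a))
        \<le> B * (norm (a - c) + norm (b - c)) * norm (b - a)"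
      by (simp only: m_def D_def)
  qed
qed

section \<open>Taylor expansion along a solution\<close>

text \<open>The mean value inequality on the segment from 0 to s, with the derivative bounded by its
  majorant at the far end. The factor 1/(k+1) of integration is given up, since only orders
  matter.\<close>

lemma norm_le_power_Suc_if_derivative_le:
  fixes \<phi> :: "real \<Rightarrow> 'a::real_normed_vector"
  assumes "convex T" "0 \<in> T" "0 \<le> B"
    and "\<And>s. s \<in> T \<Longrightarrow> (\<phi> has_vector_derivative \<phi>' s) (at s within T)"
    and "\<And>s. s \<in> T \<Longrightarrow> norm (\<phi>' s) \<le> B * \<bar>s\<bar> ^ k"
    and s: "s \<in> T"
  shows "norm (\<phi> s - \<phi> 0) \<le> B * \<bar>s\<bar> ^ Suc k"
proof -
  have sub: "closed_segment 0 s \<subseteq> T" using assms by (intro closed_segment_subset) auto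
  have "norm (\<phi> s - \<phi> 0) \<le> (B * \<bar>s\<bar> ^ k) * norm (s - 0)"
  proof (rule differentiable_bound[of "closed_segment 0 s" _ "\<lambda>t x. x *\<^sub>R \<phi>' t"])
    fix t assume t: "t \<in> closed_segment 0 s"
    then have tT: "t \<in> T" using sub by blast
    show "(\<phi> has_derivative (\<lambda>x. x *\<^sub>R \<phi>' t)) (at t within closed_segment 0 s)"
      using has_vector_derivative_within_subset[OF assms(4)[OF tT] sub]
      by (simp add: has_vector_derivative_def)
    have "\<bar>t\<bar> \<le> \<bar>s\<bar>" using t by (auto simp: closed_segment_eq_real_ivl split: if_splits)
    then have "B * \<bar>t\<bar> ^ k \<le> B * \<bar>s\<bar> ^ k" using assms(3) by (intro mult_left_mono power_mono) auto
    then have "norm (\<phi>' t) \<le> B * \<bar>s\<bar> ^ k" using assms(5)[OF tT] by linarith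
    then show "onorm (\<lambda>x. x *\<^sub>R \<phi>' t) \<le> B * \<bar>s\<bar> ^ k"
      by (simp add: onorm_scaleR_left[OF bounded_linear_ident] onorm_id)
  qed auto
  then show ?thesis by (simp add: mult_ac)
qed

text \<open>A vector-valued function has no intermediate-point remainder, so the remainder is
  estimated by induction on the order: its derivative is the remainder of the shifted family, one
  order lower. Derivatives within \<open>T\<close> admit an expansion point at the end of the
  interval.\<close>

lemma Taylor_vector_within:
  fixes \<phi> :: "nat \<Rightarrow> real \<Rightarrow> 'a::real_normed_vector"
  assumes T: "convex T" "0 \<in> T" and B: "0 \<le> B"
    and "\<And>i s. i < n \<Longrightarrow> s \<in> T \<Longrightarrow> (\<phi> i has_vector_derivative \<phi> (Suc i) s) (at s within T)"
    and "\<And>s. s \<in> T \<Longrightarrow> norm (\<phi> n s) \<le> B"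
    and "s \<in> T"
  shows "norm (\<phi> 0 s - (\<Sum>i<n. (s ^ i / fact i) *\<^sub>R \<phi> i 0)) \<le> B * \<bar>s\<bar> ^ n"
  using assms(4-6)
proof (induction n arbitrary: \<phi> s)
  case 0
  then show ?case by simp
next
  case (Suc n)
  \<comment> \<open>The Taylor remainder: it vanishes at 0, and its derivative is covered by the
    induction hypothesis for the family shifted by one.\<close>
  define \<psi> where "\<psi> s = \<phi> 0 s - (\<Sum>i<Suc n. (s ^ i / fact i) *\<^sub>R \<phi> i 0)" for s
  have sum: "(\<Sum>i<Suc n. (s ^ i / fact i) *\<^sub>R \<phi> i 0)
    = \<phi> 0 0 + (\<Sum>i<n. (s ^ Suc i / fact (Suc i)) *\<^sub>R \<phi> (Suc i) 0)" for s
    by (subst sum.lessThan_Suc_shift) simp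
  have der: "(\<psi> has_vector_derivative \<phi> (Suc 0) s - (\<Sum>i<n. (s ^ i / fact i) *\<^sub>R \<phi> (Suc i) 0)) (at s within T)"
    if "s \<in> T" for s
  proof -
    have "((\<lambda>s. (s ^ Suc i / fact (Suc i)) *\<^sub>R \<phi> (Suc i) 0) has_vector_derivative
        (s ^ i / fact i) *\<^sub>R \<phi> (Suc i) 0) (at s within T)" for i
    proof -
      have "((\<lambda>s. s ^ Suc i / fact (Suc i)) has_field_derivative
          (1 + real i) * s ^ i / fact (Suc i)) (at s within T)"
        by (auto intro!: derivative_eq_intros simp del: power_Suc fact_Suc)
      moreover have "(1 + real i) * s ^ i / fact (Suc i) = s ^ i / fact i"
        by (simp add: add.commute divide_simps)
      ultimately show ?thesis
        using has_vector_derivative_scaleR[of _ _ s T "\<lambda>_. \<phi> (Suc i) 0" 0] by fastforce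
    qed
    then have "((\<lambda>s. \<phi> 0 s - (\<phi> 0 0 + (\<Sum>i<n. (s ^ Suc i / fact (Suc i)) *\<^sub>R \<phi> (Suc i) 0)))
        has_vector_derivative \<phi> (Suc 0) s - (0 + (\<Sum>i<n. (s ^ i / fact i) *\<^sub>R \<phi> (Suc i) 0))) (at s within T)"
      using Suc.prems(1)[of 0 s] that
      by (intro has_vector_derivative_diff has_vector_derivative_add has_vector_derivative_const
        has_vector_derivative_sum) auto
    then show ?thesis by (simp only: \<psi>_def[abs_def] sum add_0)
  qed
  have "norm (\<psi> s - \<psi> 0) \<le> B * \<bar>s\<bar> ^ Suc n"
  proof (rule norm_le_power_Suc_if_derivative_le[OF T B der _ Suc.prems(3)])
    fix t assume "t \<in> T"
    then show "norm (\<phi> (Suc 0) t - (\<Sum>i<n. (t ^ i / fact i) *\<^sub>R \<phi> (Suc i) 0)) \<le> B * \<bar>t\<bar> ^ n"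
      using Suc.IH[of "\<lambda>i. \<phi> (Suc i)" t] Suc.prems(1,2) by auto
  qed
  moreover have "\<psi> 0 = 0" unfolding \<psi>_def sum by simp
  ultimately show ?case by (simp add: \<psi>_def)
qed

section \<open>Composition with smooth functions\<close>

lemma h_order_mult_h:
  assumes "h_order F k \<phi>" "n = Suc k"
  shows "h_order F n (\<lambda>h. (c * h) *\<^sub>R \<phi> h)"
  using h_order_scaleR[OF h_order_mult[OF h_order_power[of F 1] assms(1)], of c] assms(2) by simp

lemma h_order_eq:
  assumes "h_order F k \<phi>" "\<And>h. \<psi> h = \<phi> h"
  shows "h_order F k \<psi>"
  using assms by presburger

lemma h_order_vec:
  fixes \<phi> :: "real \<Rightarrow> real ^ 'n::finite"
  assumes "\<And>\<nu>. h_order F k (\<lambda>h. \<phi> h $ \<nu>)"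
  shows "h_order F k \<phi>"
proof (rule h_order_le[of F k "\<lambda>h. \<Sum>\<nu>\<in>UNIV. \<bar>\<phi> h $ \<nu>\<bar>" _ 1])
  show "h_order F k (\<lambda>h. \<Sum>\<nu>\<in>UNIV. \<bar>\<phi> h $ \<nu>\<bar>)"
    using assms by (intro h_order_sum) (simp add: h_order_def)
  show "\<forall>\<^sub>F h in F. norm (\<phi> h) \<le> 1 * norm (\<Sum>\<nu>\<in>UNIV. \<bar>\<phi> h $ \<nu>\<bar>)"
    using norm_le_l1_cart by (intro always_eventually) fastforce
qed

lemma h_order_eventually_in_cball:
  fixes X :: "real \<Rightarrow> 'a::real_normed_vector"
  assumes "h_order F 1 (\<lambda>h. X h - x0)" "F \<le> nhds 0" "0 < r"
  shows "\<forall>\<^sub>F h in F. X h \<in> cball x0 r"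
proof -
  have "(X \<longlongrightarrow> x0) F" using assms by (intro h_order_tendsto[of F 0]) auto
  then have "\<forall>\<^sub>F h in F. dist (X h) x0 < r" using assms(3) by (rule tendstoD)
  then show ?thesis by eventually_elim (simp add: dist_commute)
qed

lemma h_order_compose_diff:
  fixes \<phi> :: "'a::euclidean_space \<Rightarrow> 'b::real_normed_vector"
  assumes "open S" "Ck_on (Suc 0) S \<phi>" "x0 \<in> S" "F \<le> nhds 0"
    and "h_order F 1 (\<lambda>h. X h - x0)" "h_order F 1 (\<lambda>h. X' h - x0)"
    and "h_order F k (\<lambda>h. X h - X' h)"
  shows "h_order F k (\<lambda>h. \<phi> (X h) - \<phi> (X' h))"
proof -
  obtain r B where r: "0 < r"
    "\<And>x x'. x \<in> cball x0 r \<Longrightarrow> x' \<in> cball x0 r \<Longrightarrow> norm (\<phi> x - \<phi> x') \<le> B * norm (x - x')"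
    using Ck_on_locally_Lipschitz[OF assms(1-3)] by metis
  have "\<forall>\<^sub>F h in F. norm (\<phi> (X h) - \<phi> (X' h)) \<le> B * norm (X h - X' h)"
    using h_order_eventually_in_cball[OF assms(5,4) r(1)] h_order_eventually_in_cball[OF assms(6,4) r(1)]
    by eventually_elim (rule r(2))
  with assms(7) show ?thesis by (rule h_order_le)
qed

lemma h_order_norm: "h_order F k \<phi> \<Longrightarrow> h_order F k (\<lambda>h. norm (\<phi> h))"
  by (simp add: h_order_def)

text \<open>Both arguments are within O(h) of x0, so freezing the derivative there gains one power
  of h over \<open>X - X'\<close>. For deviations of order h^2 this leaves O(h^3), which suffices
  for the embedded scheme but not for stages 2 and 3 of the final one.\<close>

lemma h_order_linearize:
  fixes f :: "'a::euclidean_space \<Rightarrow> 'b::real_normed_vector"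
  assumes "open S" "Ck_on (Suc (Suc 0)) S f" "x0 \<in> S" "F \<le> nhds 0"
    and "h_order F 1 (\<lambda>h. X h - x0)" "h_order F 1 (\<lambda>h. X' h - x0)"
    and "h_order F k (\<lambda>h. X h - X' h)"
  shows "h_order F (Suc k) (\<lambda>h. f (X h) - f (X' h) - frechet_derivative f (at x0) (X h - X' h))"
proof -
  obtain r B where r: "0 < r" and "0 \<le> B" "cball x0 r \<subseteq> S"
    "\<And>x c v. x \<in> cball x0 r \<Longrightarrow> c \<in> cball x0 r \<Longrightarrow>
      norm (frechet_derivative f (at x) v - frechet_derivative f (at c) v) \<le> B * norm (x - c) * norm v"
    and lin: "\<And>a b c. a \<in> cball x0 r \<Longrightarrow> b \<in> cball x0 r \<Longrightarrow> c \<in> cball x0 r \<Longrightarrow>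
      norm (f b - f a - frechet_derivative f (at c) (b - a))
        \<le> B * (norm (a - c) + norm (b - c)) * norm (b - a)"
    by (rule Ck_on_derivative_locally_Lipschitz[OF assms(1-3)]) (rule that)
  have "x0 \<in> cball x0 r" using r by simp
  have "h_order F (Suc k) (\<lambda>h. (norm (X' h - x0) + norm (X h - x0)) *\<^sub>R (X h - X' h))"
    using h_order_mult[OF h_order_add[OF h_order_norm[OF assms(6)] h_order_norm[OF assms(5)]] assms(7)]
    by simp
  moreover have "\<forall>\<^sub>F h in F. norm (f (X h) - f (X' h) - frechet_derivative f (at x0) (X h - X' h))
      \<le> B * norm ((norm (X' h - x0) + norm (X h - x0)) *\<^sub>R (X h - X' h))"
    using h_order_eventually_in_cball[OF assms(5,4) r] h_order_eventually_in_cball[OF assms(6,4) r]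
  proof eventually_elim
    case (elim h)
    from lin[OF elim(2,1) \<open>x0 \<in> cball x0 r\<close>] show ?case by (simp add: mult.assoc)
  qed
  ultimately show ?thesis by (rule h_order_le)
qed

text \<open>Deviations of order \<open>h\<^sup>2\<close> whose sum has order \<open>h\<^sup>3\<close>: the derivative may be frozen at \<open>x0\<close>
  although it would cost a term of order \<open>h\<^sup>3\<close> for each deviation separately.\<close>

lemma h_order_linearize_pair:
  fixes f :: "'a::euclidean_space \<Rightarrow> 'b::real_normed_vector"
  assumes "open S" "Ck_on (Suc (Suc 0)) S f" "x0 \<in> S" "F \<le> nhds 0"
    and X: "h_order F 1 (\<lambda>h. X h - x0)" "h_order F 1 (\<lambda>h. X1 h - x0)" "h_order F 1 (\<lambda>h. X2 h - x0)"
    and X12: "h_order F 2 (\<lambda>h. X1 h - X h)" "h_order F 2 (\<lambda>h. X2 h - X h)"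
    and sum: "h_order F 3 (\<lambda>h. (X1 h - X h) + (X2 h - X h))"
  shows "h_order F 4 (\<lambda>h. (f (X1 h) - f (X h)) + (f (X2 h) - f (X h))
    - frechet_derivative f (at x0) ((X1 h - X h) + (X2 h - X h)))"
proof -
  obtain r B where r: "0 < r" and "0 \<le> B" and sub: "cball x0 r \<subseteq> S" and
    D: "\<And>x c v. x \<in> cball x0 r \<Longrightarrow> c \<in> cball x0 r \<Longrightarrow>
      norm (frechet_derivative f (at x) v - frechet_derivative f (at c) v) \<le> B * norm (x - c) * norm v" and
    lin: "\<And>a b c. a \<in> cball x0 r \<Longrightarrow> b \<in> cball x0 r \<Longrightarrow> c \<in> cball x0 r \<Longrightarrow>
      norm (f b - f a - frechet_derivative f (at c) (b - a))
        \<le> B * (norm (a - c) + norm (b - c)) * norm (b - a)"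
    by (rule Ck_on_derivative_locally_Lipschitz[OF assms(1-3)]) (rule that)
  have c: "x0 \<in> cball x0 r" using r by simp
  let ?N = "\<lambda>h. norm (X1 h - X h) *\<^sub>R norm (X1 h - X h) + norm (X2 h - X h) *\<^sub>R norm (X2 h - X h)
     + norm (X h - x0) *\<^sub>R norm ((X1 h - X h) + (X2 h - X h))"
  have "h_order F 4 ?N"
    using h_order_mult[OF X12(1)[THEN h_order_norm] X12(1)[THEN h_order_norm]]
      h_order_mult[OF X12(2)[THEN h_order_norm] X12(2)[THEN h_order_norm]]
      h_order_mult[OF X(1)[THEN h_order_norm] sum[THEN h_order_norm]]
    by (intro h_order_add) simp_all
  moreover have "\<forall>\<^sub>F h in F. norm ((f (X1 h) - f (X h)) + (f (X2 h) - f (X h))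
      - frechet_derivative f (at x0) ((X1 h - X h) + (X2 h - X h))) \<le> B * norm (?N h)"
    using X[THEN h_order_eventually_in_cball, OF assms(4) r]
  proof eventually_elim
    case (elim h)
    have "linear (frechet_derivative f (at (X h)))"
      using assms(2) elim(1) sub by (intro linear_frechet_derivative) auto
    \<comment> \<open>Linearizing at \<open>X h\<close> leaves quadratic remainders of order h^4;
      only afterwards is the base point moved to x0, and only for the sum of the deviations.\<close>
    then have split: "(f (X1 h) - f (X h)) + (f (X2 h) - f (X h))
        - frechet_derivative f (at x0) ((X1 h - X h) + (X2 h - X h))
      = (f (X1 h) - f (X h) - frechet_derivative f (at (X h)) (X1 h - X h))
        + (f (X2 h) - f (X h) - frechet_derivative f (at (X h)) (X2 h - X h))
        + (frechet_derivative f (at (X h)) ((X1 h - X h) + (X2 h - X h))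
            - frechet_derivative f (at x0) ((X1 h - X h) + (X2 h - X h)))" (is "_ = ?a + ?b + ?c")
      by (simp add: linear_add)
    have "norm ?a \<le> B * (norm (X1 h - X h) * norm (X1 h - X h))"
      using lin[OF elim(1,2,1)] by (simp add: mult.assoc)
    moreover have "norm ?b \<le> B * (norm (X2 h - X h) * norm (X2 h - X h))"
      using lin[OF elim(1,3,1)] by (simp add: mult.assoc)
    moreover have "norm ?c \<le> B * (norm (X h - x0) * norm ((X1 h - X h) + (X2 h - X h)))"
      using D[OF elim(1) c] by (simp add: mult.assoc)
    moreover have "norm (?a + ?b + ?c) \<le> norm ?a + norm ?b + norm ?c"
      by (intro norm_triangle_le add_mono norm_triangle_ineq order_refl)
    moreover have "norm (?N h) = ?N h" by (simp add: abs_of_nonneg)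
    ultimately show ?case unfolding split by (simp add: distrib_left)
  qed
  ultimately show ?thesis by (rule h_order_le)
qed

lemma open_positive_orthant: "open (positive_orthant :: (real ^ 'n::finite) set)"
proof -
  have "positive_orthant = (\<Inter>k. {x :: real ^ 'n. 0 < x $ k})"
    by (auto simp: positive_orthant_def)
  also have "open \<dots>"
    by (simp add: open_INT open_Collect_less continuous_on_component)
  finally show ?thesis .
qed

section \<open>Expansion of the stages\<close>

lemma h_order_monomial_ge:
  assumes "k \<le> m" "F \<le> nhds 0"
  shows "h_order F k (\<lambda>h. ((c * h) ^ m / q) *\<^sub>R v)"
proof (rule h_order_mono[OF _ assms])
  show "h_order F m (\<lambda>h. ((c * h) ^ m / q) *\<^sub>R v)"
    using h_order_monomial[of F m "(c ^ m / q) *\<^sub>R v"]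
    by (rule h_order_eq) (simp add: power_mult_distrib mult_ac)
qed

text \<open>Two derivatives of the parts are what the linearizations of the stages use. Higher
  smoothness enters separately, through the Taylor expansion of a solution.\<close>

locale patankar_scheme =
  fixes p d :: "'n::finite rates" and yn :: "real ^ 'n" and F :: "real filter"
  assumes F: "F \<le> nhds 0" and yn: "yn \<in> positive_orthant"
    and pd: "production_destruction p d"
    and smooth: "\<And>\<nu>. Ck_on (Suc (Suc 0)) positive_orthant (pds_part p d \<nu>)"
begin

text \<open>With this form the vectors \<open>A \<nu>\<close> of a stage add up to values of
  \<open>f\<close> directly. On the positive orthant, where the diagonal rates vanish, it is the
  right-hand side of the system.\<close>

definition f :: "real ^ 'n \<Rightarrow> real ^ 'n" where
  "f x = (\<Sum>\<nu>\<in>UNIV. pds_part p d \<nu> x)"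

definition J :: "real ^ 'n \<Rightarrow> real ^ 'n" where
  "J = frechet_derivative f (at yn)"

text \<open>First-order effect on a stage of replacing its weight ratios \<open>1\<close> by \<open>1 + v\<^sub>\<nu> / yn\<^sub>\<nu>\<close>.\<close>

definition G :: "real ^ 'n \<Rightarrow> real ^ 'n" where
  "G v = (\<Sum>\<nu>\<in>UNIV. (v $ \<nu> / yn $ \<nu>) *\<^sub>R pds_part p d \<nu> yn)"

abbreviation near :: "(real \<Rightarrow> real ^ 'n) \<Rightarrow> bool" where
  "near X \<equiv> h_order F 1 (\<lambda>h. X h - yn)"

lemma smooth_f: "Ck_on (Suc (Suc 0)) positive_orthant f"
  unfolding f_def[abs_def] by (intro Ck_on_sum open_positive_orthant smooth)

lemma bounded_linear_J: "bounded_linear J"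
  unfolding J_def by (rule has_derivative_bounded_linear[OF Ck_on_SucD[OF smooth_f yn]])

lemma J_simps: "J (a + b) = J a + J b" "J (a - b) = J a - J b" "J (c *\<^sub>R a) = c *\<^sub>R J a"
  using bounded_linear_J by (simp_all add: linear_simps)

lemma G_scaleR: "G (c *\<^sub>R v) = c *\<^sub>R G v"
  by (simp add: G_def scaleR_sum_right)

lemma near_const: "near (\<lambda>h. yn)"
  by (simp add: h_order_zero)

lemma near_add_monomial:
  assumes "h_order F (Suc k) (\<lambda>h. X h - (yn + (c * h) *\<^sub>R v))"
  shows "near X"
proof -
  have "h_order F 1 (\<lambda>h. X h - (yn + (c * h) *\<^sub>R v))"
    by (rule h_order_mono[OF assms _ F]) simp
  from h_order_add[OF this h_order_mult_h[OF h_order_const, of 1 F c v]] show ?thesis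
    by simp
qed

lemma part_order:
  assumes "near X"
  shows "h_order F 1 (\<lambda>h. pds_part p d \<nu> (X h) - pds_part p d \<nu> yn)"
  using h_order_compose_diff[OF open_positive_orthant Ck_on_Suc_imp[OF smooth] yn F assms near_const assms] .

lemma part_bounded:
  assumes "near X"
  shows "h_order F 0 (\<lambda>h. pds_part p d \<nu> (X h))"
  using h_order_add[OF h_order_mono[OF part_order[OF assms] _ F, of 0] h_order_const, of \<nu> "pds_part p d \<nu> yn"]
  by simp

lemma f_order:
  assumes "near X"
  shows "h_order F 1 (\<lambda>h. f (X h) - f yn)"
  using h_order_compose_diff[OF open_positive_orthant Ck_on_Suc_imp[OF smooth_f] yn F assms near_const assms] .

lemma f_linearize:
  assumes "near X" "near X'" "h_order F k (\<lambda>h. X h - X' h)"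
  shows "h_order F (Suc k) (\<lambda>h. f (X h) - f (X' h) - J (X h - X' h))"
  unfolding J_def by (rule h_order_linearize[OF open_positive_orthant smooth_f yn F assms])

lemma patankar_eq_part:
  assumes "x \<in> positive_orthant"
  shows "patankar_eq yn c (\<lambda>k \<nu>. p k \<nu> x) (\<lambda>k \<nu>. d k \<nu> x) w z
    \<longleftrightarrow> patankar_vec yn c (\<lambda>\<nu>. pds_part p d \<nu> x) w z"
  using assms pd by (intro patankar_eq_vec) (auto simp: production_destruction_def pds_part_def)

lemma patankar_eq_parts3:
  assumes "x1 \<in> positive_orthant" "x2 \<in> positive_orthant" "x3 \<in> positive_orthant"
  shows "patankar_eq yn c (\<lambda>k \<nu>. 2 * p k \<nu> x1 + 3 * p k \<nu> x2 + 4 * p k \<nu> x3)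
      (\<lambda>k \<nu>. 2 * d k \<nu> x1 + 3 * d k \<nu> x2 + 4 * d k \<nu> x3) w z
    \<longleftrightarrow> patankar_vec yn c (\<lambda>\<nu>. 2 *\<^sub>R pds_part p d \<nu> x1 + 3 *\<^sub>R pds_part p d \<nu> x2
          + 4 *\<^sub>R pds_part p d \<nu> x3) w z"
  using assms pd
  by (intro patankar_eq_vec)
    (auto simp: production_destruction_def pds_part_def vec_eq_iff sum.distrib sum_distrib_left)

lemma patankar_eq_parts4:
  assumes "x1 \<in> positive_orthant" "x2 \<in> positive_orthant" "x3 \<in> positive_orthant" "x4 \<in> positive_orthant"
  shows "patankar_eq yn c (\<lambda>k \<nu>. p k \<nu> x1 + 2 * p k \<nu> x2 + 2 * p k \<nu> x3 + p k \<nu> x4)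
      (\<lambda>k \<nu>. d k \<nu> x1 + 2 * d k \<nu> x2 + 2 * d k \<nu> x3 + d k \<nu> x4) w z
    \<longleftrightarrow> patankar_vec yn c (\<lambda>\<nu>. pds_part p d \<nu> x1 + 2 *\<^sub>R pds_part p d \<nu> x2
          + 2 *\<^sub>R pds_part p d \<nu> x3 + pds_part p d \<nu> x4) w z"
  using assms pd
  by (intro patankar_eq_vec)
    (auto simp: production_destruction_def pds_part_def vec_eq_iff sum.distrib sum_distrib_left)

text \<open>The last two conclusions are kept as rules in k because a stage uses them repeatedly:
  each expansion obtained for \<open>Z\<close> sharpens the bound on \<open>Z - w\<close> that the
  next application needs. The last rule yields the term in \<open>G\<close> at the point where stage
  and weight start to differ.\<close>

lemma patankar_stage:
  fixes \<kappa> :: real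
  assumes A: "\<And>\<nu>. h_order F 0 (\<lambda>h. A h \<nu>)" and w: "near w"
  obtains Z where "\<forall>\<^sub>F h in F. \<forall>z. patankar_vec yn (\<kappa> * h) (A h) (w h) z \<longleftrightarrow> z = Z h"
    and "near Z"
    and "\<And>k. h_order F k (\<lambda>h. Z h - w h) \<Longrightarrow>
      h_order F (Suc k) (\<lambda>h. Z h - (yn + (\<kappa> * h) *\<^sub>R (\<Sum>\<nu>\<in>UNIV. A h \<nu>)))"
    and "\<And>k v. (\<And>\<nu>. h_order F 1 (\<lambda>h. A h \<nu> - pds_part p d \<nu> yn)) \<Longrightarrow>
      h_order F (Suc k) (\<lambda>h. Z h - w h - (h ^ k) *\<^sub>R v) \<Longrightarrow>
      h_order F (Suc (Suc k)) (\<lambda>h. Z h - (yn + (\<kappa> * h) *\<^sub>R (\<Sum>\<nu>\<in>UNIV. A h \<nu>))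
        - (h ^ Suc k) *\<^sub>R (\<kappa> *\<^sub>R G v))"
proof -
  obtain Z where Z: "\<forall>\<^sub>F h in F. \<forall>z. patankar_vec yn (\<kappa> * h) (A h) (w h) z \<longleftrightarrow> z = Z h" "near Z"
    by (rule patankar_vec_solution[OF F yn A w]) (rule that)
  have Z': "\<forall>\<^sub>F h in F. patankar_vec yn (\<kappa> * h) (A h) (w h) (Z h)"
    using Z(1) by eventually_elim blast
  show ?thesis
  proof (rule that[OF Z])
    fix k assume "h_order F k (\<lambda>h. Z h - w h)"
    then show "h_order F (Suc k) (\<lambda>h. Z h - (yn + (\<kappa> * h) *\<^sub>R (\<Sum>\<nu>\<in>UNIV. A h \<nu>)))"
      by (rule patankar_vec_order[OF F yn A w Z'])
  next
    fix k v
    assume "\<And>\<nu>. h_order F 1 (\<lambda>h. A h \<nu> - pds_part p d \<nu> yn)"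
      and "h_order F (Suc k) (\<lambda>h. Z h - w h - (h ^ k) *\<^sub>R v)"
    then show "h_order F (Suc (Suc k)) (\<lambda>h. Z h - (yn + (\<kappa> * h) *\<^sub>R (\<Sum>\<nu>\<in>UNIV. A h \<nu>))
        - (h ^ Suc k) *\<^sub>R (\<kappa> *\<^sub>R G v))"
      unfolding G_def by (rule patankar_vec_order_leading[OF F yn _ w Z'])
  qed
qed

text \<open>Componentwise y2^2 / yn = yn + 2 (y2 - yn) + (y2 - yn)^2 / yn. The linear coefficient
  doubles, so a stage at half a step yields a weight that follows the solution at the full
  step.\<close>

lemma hat_weight_order:
  assumes Y2: "h_order F 2 (\<lambda>h. Y2 h - (yn + (c * h) *\<^sub>R v))"
  shows "h_order F 2 (\<lambda>h. hat_weight yn (Y2 h) - (yn + (2 * c * h) *\<^sub>R v))"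
proof -
  have near: "near Y2"
    using near_add_monomial[of 1 Y2 c v] Y2 by (simp add: numeral_2_eq_2)
  have sq: "h_order F 2 (\<lambda>h. hat_weight yn (Y2 h) - yn - 2 *\<^sub>R (Y2 h - yn))"
  proof (rule h_order_vec)
    fix \<nu>
    have "h_order F 2 (\<lambda>h. (Y2 h - yn) $ \<nu> *\<^sub>R (Y2 h - yn) $ \<nu>)"
      using h_order_mult[OF h_order_component[OF near] h_order_component[OF near]]
      by (simp add: numeral_2_eq_2)
    from h_order_scaleR[OF this, of "inverse (yn $ \<nu>)"]
    show "h_order F 2 (\<lambda>h. (hat_weight yn (Y2 h) - yn - 2 *\<^sub>R (Y2 h - yn)) $ \<nu>)"
      by (rule h_order_eq)
        (use positive_orthant_nonzero[OF yn, of \<nu>] in \<open>simp add: hat_weight_def field_simps power2_eq_square\<close>)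
  qed
  from h_order_add[OF this h_order_scaleR[OF Y2, of 2]] show ?thesis
    by (rule h_order_eq) (simp add: algebra_simps)
qed

text \<open>\<open>S\<close> is the midpoint rule with a weight that agrees with it up to O(h^2), so
  the weight disturbs it only at O(h^3) and it matches the solution at \<kappa> h through second
  order. The factor \<kappa> serves both the full step and the half step.\<close>

lemma hat_sigma_expansion:
  fixes \<kappa> :: real
  obtains Y2 S where
    "\<forall>\<^sub>F h in F. \<forall>y2 s. hat_sigma p d yn (\<kappa> * h) y2 s \<longleftrightarrow> y2 = Y2 h \<and> s = S h"
    and "near Y2" "near S"
    and "h_order F 2 (\<lambda>h. Y2 h - (yn + (\<kappa> / 2 * h) *\<^sub>R f yn))"
    and "h_order F 3 (\<lambda>h. Y2 h - (yn + (\<kappa> / 2 * h) *\<^sub>R f yn + ((\<kappa> * h)\<^sup>2 / 4) *\<^sub>R G (f yn)))"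
    and "h_order F 2 (\<lambda>h. f (Y2 h) - (f yn + (\<kappa> / 2 * h) *\<^sub>R J (f yn)))"
    and "h_order F 3 (\<lambda>h. S h - (yn + (\<kappa> * h) *\<^sub>R f yn + ((\<kappa> * h)\<^sup>2 / 2) *\<^sub>R J (f yn)))"
proof -
  obtain Y2 where Y2: "\<forall>\<^sub>F h in F. \<forall>z. patankar_vec yn (\<kappa> / 2 * h) (\<lambda>\<nu>. pds_part p d \<nu> yn) yn z \<longleftrightarrow> z = Y2 h"
    "near Y2"
    "\<And>k. h_order F k (\<lambda>h. Y2 h - yn) \<Longrightarrow>
      h_order F (Suc k) (\<lambda>h. Y2 h - (yn + (\<kappa> / 2 * h) *\<^sub>R f yn))"
    "\<And>k v. h_order F (Suc k) (\<lambda>h. Y2 h - yn - (h ^ k) *\<^sub>R v) \<Longrightarrow>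
      h_order F (Suc (Suc k)) (\<lambda>h. Y2 h - (yn + (\<kappa> / 2 * h) *\<^sub>R f yn)
        - (h ^ Suc k) *\<^sub>R ((\<kappa> / 2) *\<^sub>R G v))"
    by (rule patankar_stage[of "\<lambda>h \<nu>. pds_part p d \<nu> yn" "\<lambda>h. yn" "\<kappa> / 2"])
      (auto simp: f_def h_order_zero h_order_const)
  have Y2_2: "h_order F 2 (\<lambda>h. Y2 h - (yn + (\<kappa> / 2 * h) *\<^sub>R f yn))"
    using Y2(3)[OF Y2(2)] by (simp add: numeral_2_eq_2)
  \<comment> \<open>Here the weight is \<open>yn\<close> itself, so stage and weight already differ
    by (\<kappa>/2) h f(yn); this is the source of the second-order term in
    \<open>G\<close>.\<close>
  have "h_order F (Suc 1) (\<lambda>h. Y2 h - yn - h ^ 1 *\<^sub>R ((\<kappa> / 2) *\<^sub>R f yn))"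
    unfolding Suc_1 by (rule h_order_eq[OF Y2_2]) (simp add: algebra_simps)
  from Y2(4)[OF this]
  have Y2_3: "h_order F 3 (\<lambda>h. Y2 h - (yn + (\<kappa> / 2 * h) *\<^sub>R f yn + ((\<kappa> * h)\<^sup>2 / 4) *\<^sub>R G (f yn)))"
    unfolding Suc_1 eval_nat_numeral(3)[symmetric]
    by (rule h_order_eq) (simp add: G_scaleR algebra_simps power2_eq_square)
  define W where "W h = hat_weight yn (Y2 h)" for h
  have W_2: "h_order F 2 (\<lambda>h. W h - (yn + (\<kappa> * h) *\<^sub>R f yn))"
    using hat_weight_order[OF Y2_2] by (simp add: W_def)
  then have W: "near W"
    using near_add_monomial[of 1 W] by (simp add: numeral_2_eq_2)
  obtain S where S: "\<forall>\<^sub>F h in F. \<forall>z. patankar_vec yn (\<kappa> * h) (\<lambda>\<nu>. pds_part p d \<nu> (Y2 h)) (W h) z \<longleftrightarrow> z = S h"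
    "near S"
    "\<And>k. h_order F k (\<lambda>h. S h - W h) \<Longrightarrow>
      h_order F (Suc k) (\<lambda>h. S h - (yn + (\<kappa> * h) *\<^sub>R f (Y2 h)))"
    by (rule patankar_stage[of "\<lambda>h \<nu>. pds_part p d \<nu> (Y2 h)" W \<kappa>])
      (use W part_bounded[OF Y2(2)] in \<open>auto simp: f_def\<close>)
  have f2: "h_order F 2 (\<lambda>h. f (Y2 h) - (f yn + (\<kappa> / 2 * h) *\<^sub>R J (f yn)))"
    using h_order_add[OF f_linearize[OF Y2(2) near_const Y2(2), unfolded Suc_1]
        h_order_bounded_linear[OF Y2_2 bounded_linear_J]]
    by (rule h_order_eq) (simp add: J_simps algebra_simps)
  \<comment> \<open>Bootstrapping starts from closeness to \<open>yn\<close> alone. The first pass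
    shows that \<open>S\<close> and \<open>W\<close> share the linear term \<kappa> h f(yn), the
    second gives third-order accuracy relative to the midpoint rule.\<close>
  have "h_order F 1 (\<lambda>h. S h - W h)"
    using h_order_diff[OF S(2) W] by simp
  from h_order_diff[OF h_order_add[OF S(3)[OF this, unfolded Suc_1] h_order_mult_h[OF f_order[OF Y2(2)] Suc_1[symmetric], of \<kappa>]] W_2]
  have "h_order F 2 (\<lambda>h. S h - W h)"
    by (rule h_order_eq) (simp add: algebra_simps)
  from S(3)[OF this] have "h_order F 3 (\<lambda>h. S h - (yn + (\<kappa> * h) *\<^sub>R f (Y2 h)))"
    by (simp add: numeral_3_eq_3 numeral_2_eq_2)
  from h_order_add[OF this h_order_mult_h[OF f2, of 3 \<kappa>]]
  have S_3: "h_order F 3 (\<lambda>h. S h - (yn + (\<kappa> * h) *\<^sub>R f yn + ((\<kappa> * h)\<^sup>2 / 2) *\<^sub>R J (f yn)))"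
    by (rule h_order_eq) (simp_all add: algebra_simps power2_eq_square)
  have "\<forall>\<^sub>F h in F. \<forall>y2 s. hat_sigma p d yn (\<kappa> * h) y2 s \<longleftrightarrow> y2 = Y2 h \<and> s = S h"
    using Y2(1) S(1) eventually_positive_orthant[OF F yn Y2(2)]
  proof eventually_elim
    case (elim h)
    have "1 / 2 * (\<kappa> * h) = \<kappa> / 2 * h" by simp
    then show ?case
      using elim unfolding hat_sigma_def W_def
      by (auto simp only: patankar_eq_part[OF yn] patankar_eq_part)
  qed
  then show ?thesis
    using that Y2(2) S(2) Y2_2 Y2_3 f2 S_3 by blast
qed

end

text \<open>\<open>g2\<close> and \<open>g3\<close> stand for the third and fourth derivative of the
  solution at the start of the step, equivalently the second and third derivative of f along it, so
  both expansions share them. The scalar a ranges over the nodes of both schemes.\<close>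

locale patankar_scheme_solution = patankar_scheme p d yn F
  for p d :: "'n::finite rates" and yn :: "real ^ 'n" and F :: "real filter" +
  fixes Y :: "real \<Rightarrow> real ^ 'n" and g2 g3 :: "real ^ 'n"
  assumes Y_expansion: "\<And>a. 0 \<le> a \<Longrightarrow> a \<le> 1 \<Longrightarrow> h_order F 5 (\<lambda>h. Y (a * h) - (yn + (a * h) *\<^sub>R f yn
      + ((a * h)\<^sup>2 / 2) *\<^sub>R J (f yn) + ((a * h) ^ 3 / 6) *\<^sub>R g2 + ((a * h) ^ 4 / 24) *\<^sub>R g3))"
    and f_expansion: "\<And>a. 0 \<le> a \<Longrightarrow> a \<le> 1 \<Longrightarrow> h_order F 4 (\<lambda>h. f (Y (a * h)) - (f yn
      + (a * h) *\<^sub>R J (f yn) + ((a * h)\<^sup>2 / 2) *\<^sub>R g2 + ((a * h) ^ 3 / 6) *\<^sub>R g3))"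
begin

lemma Y_expansion_4:
  assumes "0 \<le> a" "a \<le> 1"
  shows "h_order F 4 (\<lambda>h. Y (a * h) - (yn + (a * h) *\<^sub>R f yn
      + ((a * h)\<^sup>2 / 2) *\<^sub>R J (f yn) + ((a * h) ^ 3 / 6) *\<^sub>R g2))"
  using h_order_add[OF h_order_mono[OF Y_expansion[OF assms] _ F, of 4]
      h_order_monomial_ge[OF order_refl F, of 4 a 24 g3]]
  by (simp add: algebra_simps)

lemma Y_expansion_3:
  assumes "0 \<le> a" "a \<le> 1"
  shows "h_order F 3 (\<lambda>h. Y (a * h) - (yn + (a * h) *\<^sub>R f yn + ((a * h)\<^sup>2 / 2) *\<^sub>R J (f yn)))"
  using h_order_add[OF h_order_mono[OF Y_expansion_4[OF assms] _ F, of 3]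
      h_order_monomial_ge[OF order_refl F, of 3 a 6 g2]]
  by (simp add: algebra_simps)

lemma Y_expansion_2:
  assumes "0 \<le> a" "a \<le> 1"
  shows "h_order F 2 (\<lambda>h. Y (a * h) - (yn + (a * h) *\<^sub>R f yn))"
  using h_order_add[OF h_order_mono[OF Y_expansion_3[OF assms] _ F, of 2]
      h_order_monomial_ge[OF order_refl F, of 2 a 2 "J (f yn)"]]
  by (simp add: algebra_simps)

lemma near_Y:
  assumes "0 \<le> a" "a \<le> 1"
  shows "near (\<lambda>h. Y (a * h))"
  using near_add_monomial[of 1 "\<lambda>h. Y (a * h)"] Y_expansion_2[OF assms] by (simp add: numeral_2_eq_2)

lemma f_expansion_3:
  assumes "0 \<le> a" "a \<le> 1"
  shows "h_order F 3 (\<lambda>h. f (Y (a * h)) - (f yn + (a * h) *\<^sub>R J (f yn) + ((a * h)\<^sup>2 / 2) *\<^sub>R g2))"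
  using h_order_add[OF h_order_mono[OF f_expansion[OF assms] _ F, of 3]
      h_order_monomial_ge[OF order_refl F, of 3 a 6 g3]]
  by (simp add: algebra_simps)

text \<open>The underlying method has nodes 0, 1/2, 3/4 and weights 2/9, 3/9, 4/9, a quadrature
  exact for quadratics. The result matches the solution up to O(h^4), the accuracy that the weight
  of the last stage of the final scheme must have.\<close>

lemma hat_next_expansion:
  assumes nearY2: "near Y2" and nearS: "near S"
    and Y2_2: "h_order F 2 (\<lambda>h. Y2 h - (yn + (1 / 2 * h) *\<^sub>R f yn))"
    and Y2_3: "h_order F 3 (\<lambda>h. Y2 h - (yn + (1 / 2 * h) *\<^sub>R f yn + ((1 * h)\<^sup>2 / 4) *\<^sub>R G (f yn)))"
    and fY2: "h_order F 2 (\<lambda>h. f (Y2 h) - (f yn + (1 / 2 * h) *\<^sub>R J (f yn)))"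
    and S_3: "h_order F 3 (\<lambda>h. S h - (yn + (1 * h) *\<^sub>R f yn + ((1 * h)\<^sup>2 / 2) *\<^sub>R J (f yn)))"
  obtains Z where
    "\<forall>\<^sub>F h in F. \<forall>z. hat_next p d yn h (Y2 h) (S h) z \<longleftrightarrow> z = Z h"
    and "near Z"
    and "h_order F 4 (\<lambda>h. Z h - (yn + h *\<^sub>R f yn + (h\<^sup>2 / 2) *\<^sub>R J (f yn) + (h ^ 3 / 6) *\<^sub>R g2))"
proof -
  define W where "W h = hat_weight yn (Y2 h)" for h
  have W_2: "h_order F 2 (\<lambda>h. W h - (yn + (1 * h) *\<^sub>R f yn))"
    using hat_weight_order[OF Y2_2] by (simp add: W_def)
  then have W: "near W"
    using near_add_monomial[of 1 W 1] by (simp add: numeral_2_eq_2)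
  obtain Y3 where Y3: "\<forall>\<^sub>F h in F. \<forall>z. patankar_vec yn (3 / 4 * h) (\<lambda>\<nu>. pds_part p d \<nu> (Y2 h)) (W h) z \<longleftrightarrow> z = Y3 h"
    "near Y3"
    "\<And>k. h_order F k (\<lambda>h. Y3 h - W h) \<Longrightarrow>
      h_order F (Suc k) (\<lambda>h. Y3 h - (yn + (3 / 4 * h) *\<^sub>R f (Y2 h)))"
    "\<And>k v. h_order F (Suc k) (\<lambda>h. Y3 h - W h - (h ^ k) *\<^sub>R v) \<Longrightarrow>
      h_order F (Suc (Suc k)) (\<lambda>h. Y3 h - (yn + (3 / 4 * h) *\<^sub>R f (Y2 h))
        - (h ^ Suc k) *\<^sub>R ((3 / 4) *\<^sub>R G v))"
    by (rule patankar_stage[of "\<lambda>h \<nu>. pds_part p d \<nu> (Y2 h)" W "3 / 4"])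
      (use W part_bounded[OF nearY2] part_order[OF nearY2] in \<open>auto simp: f_def\<close>)
  have "h_order F 1 (\<lambda>h. Y3 h - W h)"
    using h_order_diff[OF Y3(2) W] by simp
  from h_order_add[OF Y3(3)[OF this, unfolded Suc_1]
      h_order_mult_h[OF f_order[OF nearY2] Suc_1[symmetric], of "3 / 4"]]
  have Y3_2: "h_order F 2 (\<lambda>h. Y3 h - (yn + (3 / 4 * h) *\<^sub>R f yn))"
    by (rule h_order_eq) (simp add: algebra_simps)
  \<comment> \<open>The stage sits at node 3/4 while its weight follows node 1; the mismatch is -1/4
    h f(yn).\<close>
  from h_order_diff[OF Y3_2 W_2]
  have "h_order F (Suc 1) (\<lambda>h. Y3 h - W h - (h ^ 1) *\<^sub>R ((- 1 / 4) *\<^sub>R f yn))"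
    unfolding Suc_1 by (rule h_order_eq) (simp add: vec_eq_iff field_simps)
  from Y3(4)[OF this]
  have "h_order F 3 (\<lambda>h. Y3 h - (yn + (3 / 4 * h) *\<^sub>R f (Y2 h)) - (h ^ 2) *\<^sub>R ((- 3 / 16) *\<^sub>R G (f yn)))"
    unfolding Suc_1 eval_nat_numeral(3)[symmetric] by (rule h_order_eq) (simp only: G_scaleR scaleR_scaleR, simp)
  from h_order_add[OF this h_order_mult_h[OF fY2, of 3 "3 / 4"]]
  have Y3_3: "h_order F 3 (\<lambda>h. Y3 h - (yn + (3 / 4 * h) *\<^sub>R f yn
      + (3 / 8 * h\<^sup>2) *\<^sub>R J (f yn) - (3 / 16 * h\<^sup>2) *\<^sub>R G (f yn)))"
    by (rule h_order_eq) (simp_all add: vec_eq_iff field_simps power2_eq_square)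
  have Y2_Y: "h_order F 2 (\<lambda>h. Y2 h - Y (1 / 2 * h))"
    using h_order_diff[OF Y2_2 Y_expansion_2[of "1 / 2"]] by simp
  have Y3_Y: "h_order F 2 (\<lambda>h. Y3 h - Y (3 / 4 * h))"
    using h_order_diff[OF Y3_2 Y_expansion_2[of "3 / 4"]] by simp
  \<comment> \<open>At order h^2 the terms in \<open>G\<close> cancel by 3 * 1/4 = 4 * 3/16, and
    those in \<open>J\<close> by 3 * (-1/8) + 4 * (3/8 - 9/32) = 0.\<close>
  have dev: "h_order F 3 (\<lambda>h. 3 *\<^sub>R (Y2 h - Y (1 / 2 * h)) + 4 *\<^sub>R (Y3 h - Y (3 / 4 * h)))"
  proof (rule h_order_eq)
    show "h_order F 3 (\<lambda>h.
        3 *\<^sub>R (Y2 h - (yn + (1 / 2 * h) *\<^sub>R f yn + ((1 * h)\<^sup>2 / 4) *\<^sub>R G (f yn))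
          - (Y (1 / 2 * h) - (yn + (1 / 2 * h) *\<^sub>R f yn + ((1 / 2 * h)\<^sup>2 / 2) *\<^sub>R J (f yn))))
        + 4 *\<^sub>R (Y3 h - (yn + (3 / 4 * h) *\<^sub>R f yn
              + (3 / 8 * h\<^sup>2) *\<^sub>R J (f yn) - (3 / 16 * h\<^sup>2) *\<^sub>R G (f yn))
          - (Y (3 / 4 * h) - (yn + (3 / 4 * h) *\<^sub>R f yn + ((3 / 4 * h)\<^sup>2 / 2) *\<^sub>R J (f yn)))))"
      by (intro h_order_add h_order_diff h_order_scaleR Y2_3 Y3_3 Y_expansion_3) simp_all
  qed (simp add: vec_eq_iff field_simps power2_eq_square)
  define A where "A h \<nu> = 2 *\<^sub>R pds_part p d \<nu> yn + 3 *\<^sub>R pds_part p d \<nu> (Y2 h)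
    + 4 *\<^sub>R pds_part p d \<nu> (Y3 h)" for h \<nu>
  have sumA: "(\<Sum>\<nu>\<in>UNIV. A h \<nu>) = 2 *\<^sub>R f yn + 3 *\<^sub>R f (Y2 h) + 4 *\<^sub>R f (Y3 h)" for h
    by (simp add: A_def f_def sum.distrib scaleR_sum_right)
  \<comment> \<open>The coefficients are the moments of the quadrature: 3 * 1/2 + 4 * 3/4 = 9/2 for
    the linear term, and 3 * 1/4 + 4 * 9/16 = 3, halved by the Taylor factor to 9/6, for the
    quadratic one.\<close>
  have A_3: "h_order F 3 (\<lambda>h. (\<Sum>\<nu>\<in>UNIV. A h \<nu>)
      - 9 *\<^sub>R (f yn + (1 / 2 * h) *\<^sub>R J (f yn) + (h\<^sup>2 / 6) *\<^sub>R g2))"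
  proof (rule h_order_eq)
    show "h_order F 3 (\<lambda>h. 3 *\<^sub>R (f (Y2 h) - f (Y (1 / 2 * h)) - J (Y2 h - Y (1 / 2 * h)))
        + 4 *\<^sub>R (f (Y3 h) - f (Y (3 / 4 * h)) - J (Y3 h - Y (3 / 4 * h)))
        + J (3 *\<^sub>R (Y2 h - Y (1 / 2 * h)) + 4 *\<^sub>R (Y3 h - Y (3 / 4 * h)))
        + 3 *\<^sub>R (f (Y (1 / 2 * h)) - (f yn + (1 / 2 * h) *\<^sub>R J (f yn) + ((1 / 2 * h)\<^sup>2 / 2) *\<^sub>R g2))
        + 4 *\<^sub>R (f (Y (3 / 4 * h)) - (f yn + (3 / 4 * h) *\<^sub>R J (f yn) + ((3 / 4 * h)\<^sup>2 / 2) *\<^sub>R g2)))"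
      using f_linearize[OF nearY2 near_Y Y2_Y] f_linearize[OF Y3(2) near_Y Y3_Y]
      by (intro h_order_add h_order_scaleR f_expansion_3 h_order_bounded_linear[OF dev bounded_linear_J]) simp_all
  qed (simp only: sumA J_simps, simp add: vec_eq_iff field_simps power2_eq_square)
  obtain Z where Z: "\<forall>\<^sub>F h in F. \<forall>z. patankar_vec yn (1 / 9 * h) (A h) (S h) z \<longleftrightarrow> z = Z h"
    "near Z"
    "\<And>k. h_order F k (\<lambda>h. Z h - S h) \<Longrightarrow>
      h_order F (Suc k) (\<lambda>h. Z h - (yn + (1 / 9 * h) *\<^sub>R (\<Sum>\<nu>\<in>UNIV. A h \<nu>)))"
  proof (rule patankar_stage[of A S "1 / 9"])
    show "h_order F 0 (\<lambda>h. A h \<nu>)" for \<nu>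
      unfolding A_def by (intro h_order_add h_order_scaleR h_order_const part_bounded nearY2 Y3(2))
  qed (rule nearS, rule that)
  let ?T = "\<lambda>h. yn + h *\<^sub>R f yn + (h\<^sup>2 / 2) *\<^sub>R J (f yn) + (h ^ 3 / 6) *\<^sub>R g2"
  have step: "h_order F (Suc k) (\<lambda>h. Z h - ?T h)" if "h_order F k (\<lambda>h. Z h - S h)" "Suc k \<le> 4" for k
  proof (rule h_order_eq)
    show "h_order F (Suc k) (\<lambda>h. Z h - (yn + (1 / 9 * h) *\<^sub>R (\<Sum>\<nu>\<in>UNIV. A h \<nu>))
        + (1 / 9 * h) *\<^sub>R ((\<Sum>\<nu>\<in>UNIV. A h \<nu>)
           - 9 *\<^sub>R (f yn + (1 / 2 * h) *\<^sub>R J (f yn) + (h\<^sup>2 / 6) *\<^sub>R g2)))"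
      using h_order_mono[OF h_order_mult_h[OF A_3, of 4 "1 / 9"] that(2) F]
      by (intro h_order_add Z(3) that(1)) simp
  qed (simp add: vec_eq_iff field_simps power2_eq_square power3_eq_cube)
  have S_T: "h_order F 3 (\<lambda>h. S h - ?T h)"
    using h_order_diff[OF S_3 h_order_monomial_ge[OF order_refl F, of 3 1 6 g2]]
    by (rule h_order_eq) simp
  \<comment> \<open>The weights perturb the stage by \<open>h\<close> times the error of \<open>S\<close>, so each pass gains a power of \<open>h\<close>.\<close>
  have improve: "h_order F (Suc k) (\<lambda>h. Z h - S h)" if "h_order F k (\<lambda>h. Z h - S h)" "Suc k \<le> 3" for k
    using h_order_diff[OF step[OF that(1)] h_order_mono[OF S_T that(2) F]] that(2) by simp
  have "h_order F 1 (\<lambda>h. Z h - S h)"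
    using h_order_diff[OF Z(2) nearS] by simp
  from step[OF improve[OF improve[OF this]]] have Z_4: "h_order F 4 (\<lambda>h. Z h - ?T h)"
    by (simp add: eval_nat_numeral)
  have "\<forall>\<^sub>F h in F. \<forall>z. hat_next p d yn h (Y2 h) (S h) z \<longleftrightarrow> z = Z h"
    using Y3(1) Z(1) eventually_positive_orthant[OF F yn nearY2] eventually_positive_orthant[OF F yn Y3(2)]
  proof eventually_elim
    case (elim h)
    have "patankar_eq yn (3 / 4 * h) (\<lambda>k \<nu>. p k \<nu> (Y2 h)) (\<lambda>k \<nu>. d k \<nu> (Y2 h)) (hat_weight yn (Y2 h)) y3
        \<longleftrightarrow> y3 = Y3 h" for y3
      using elim(1,3) by (simp add: patankar_eq_part W_def)
    then show ?case
      using elim(2) patankar_eq_parts3[OF yn elim(3,4)] by (simp add: hat_next_def A_def[abs_def])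
  qed
  then show ?thesis
    using that Z(2) Z_4 by blast
qed

text \<open>Stages 2 and 3 share the weight \<open>\<rho>\<close>, from which they deviate by -h^2/8
  and +h^2/8 times \<open>J (f yn)\<close>. The resulting terms in \<open>G\<close> are therefore
  opposite, while stage 4 and its weight agree through second order and produce no such term at
  order h^3.\<close>

lemma rk4_expansion:
  assumes near_\<rho>: "near \<rho>" and nearS: "near S" and near_\<sigma>: "near \<sigma>"
    and \<rho>_3: "h_order F 3 (\<lambda>h. \<rho> h - (yn + (1 / 2 * h) *\<^sub>R f yn + ((1 / 2 * h)\<^sup>2 / 2) *\<^sub>R J (f yn)))"
    and S_3: "h_order F 3 (\<lambda>h. S h - (yn + (1 * h) *\<^sub>R f yn + ((1 * h)\<^sup>2 / 2) *\<^sub>R J (f yn)))"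
    and \<sigma>_4: "h_order F 4 (\<lambda>h. \<sigma> h - (yn + h *\<^sub>R f yn + (h\<^sup>2 / 2) *\<^sub>R J (f yn) + (h ^ 3 / 6) *\<^sub>R g2))"
  obtains Z where
    "\<forall>\<^sub>F h in F. \<forall>z. rk4_stages p d yn h (\<rho> h) (\<rho> h) (S h) (\<sigma> h) z \<longleftrightarrow> z = Z h"
    and "h_order F 5 (\<lambda>h. Z h - Y (1 * h))"
proof -
  let ?g1 = "J (f yn)"
  let ?Yh = "\<lambda>h. Y (1 / 2 * h)"
  have nearYh: "near ?Yh" and nearY: "near (\<lambda>h. Y (1 * h))"
    using near_Y[of "1 / 2"] near_Y[of 1] by simp_all
  have fYh: "h_order F 3 (\<lambda>h. f (?Yh h) - (f yn + (1 / 2 * h) *\<^sub>R ?g1 + ((1 / 2 * h)\<^sup>2 / 2) *\<^sub>R g2))"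
    by (rule f_expansion_3) simp_all
  have Yh_4: "h_order F 4 (\<lambda>h. ?Yh h - (yn + (1 / 2 * h) *\<^sub>R f yn
      + ((1 / 2 * h)\<^sup>2 / 2) *\<^sub>R ?g1 + ((1 / 2 * h) ^ 3 / 6) *\<^sub>R g2))"
    by (rule Y_expansion_4) simp_all
  have \<rho>_2: "h_order F 2 (\<lambda>h. \<rho> h - (yn + (1 / 2 * h) *\<^sub>R f yn))"
    using h_order_add[OF h_order_mono[OF \<rho>_3 _ F] h_order_monomial_ge[OF order_refl F, of 2 "1 / 2" 2 ?g1]]
    by (simp add: algebra_simps)
  have S_2: "h_order F 2 (\<lambda>h. S h - (yn + (1 * h) *\<^sub>R f yn))"
    using h_order_add[OF h_order_mono[OF S_3 _ F] h_order_monomial_ge[OF order_refl F, of 2 1 2 ?g1]]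
    by (simp add: algebra_simps)
  obtain u2 where u2: "\<forall>\<^sub>F h in F. \<forall>z. patankar_vec yn (1 / 2 * h) (\<lambda>\<nu>. pds_part p d \<nu> yn) (\<rho> h) z \<longleftrightarrow> z = u2 h"
    "near u2"
    "\<And>k. h_order F k (\<lambda>h. u2 h - \<rho> h) \<Longrightarrow>
      h_order F (Suc k) (\<lambda>h. u2 h - (yn + (1 / 2 * h) *\<^sub>R f yn))"
    "\<And>k v. h_order F (Suc k) (\<lambda>h. u2 h - \<rho> h - (h ^ k) *\<^sub>R v) \<Longrightarrow>
      h_order F (Suc (Suc k)) (\<lambda>h. u2 h - (yn + (1 / 2 * h) *\<^sub>R f yn)
        - (h ^ Suc k) *\<^sub>R ((1 / 2) *\<^sub>R G v))"
    by (rule patankar_stage[of "\<lambda>h \<nu>. pds_part p d \<nu> yn" \<rho> "1 / 2"])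
      (use near_\<rho> in \<open>auto simp: f_def h_order_zero h_order_const\<close>)
  have "h_order F 1 (\<lambda>h. u2 h - \<rho> h)"
    using h_order_diff[OF u2(2) near_\<rho>] by simp
  from h_order_diff[OF u2(3)[OF this, unfolded Suc_1] \<rho>_2]
  have "h_order F 2 (\<lambda>h. u2 h - \<rho> h)" by simp
  from u2(3)[OF this] have "h_order F 3 (\<lambda>h. u2 h - (yn + (1 / 2 * h) *\<^sub>R f yn))"
    by (simp add: eval_nat_numeral)
  \<comment> \<open>Stage 2 is an Euler half step up to O(h^3) and lacks the second-order term h^2/8
    of \<open>\<rho>\<close>.\<close>
  from h_order_diff[OF this \<rho>_3]
  have "h_order F (Suc 2) (\<lambda>h. u2 h - \<rho> h - (h ^ 2) *\<^sub>R ((- 1 / 8) *\<^sub>R ?g1))"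
    unfolding eval_nat_numeral(3)[symmetric]
    by (rule h_order_eq) (simp_all add: vec_eq_iff field_simps power2_eq_square)
  from u2(4)[OF this]
  have u2_4: "h_order F 4 (\<lambda>h. u2 h - (yn + (1 / 2 * h) *\<^sub>R f yn) - (h ^ 3) *\<^sub>R ((- 1 / 16) *\<^sub>R G ?g1))"
    unfolding Suc_numeral add_num_simps
    by (rule h_order_eq) (simp_all only: G_scaleR scaleR_scaleR, simp_all)
  have d2_4: "h_order F 4 (\<lambda>h. (u2 h - ?Yh h) + (h\<^sup>2 / 8) *\<^sub>R ?g1 + (h ^ 3 / 48) *\<^sub>R g2
      + (h ^ 3 / 16) *\<^sub>R G ?g1)"
    using h_order_diff[OF u2_4 Yh_4]
    by (rule h_order_eq) (simp add: vec_eq_iff field_simps power2_eq_square power3_eq_cube)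
  have d2_3: "h_order F 3 (\<lambda>h. (u2 h - ?Yh h) + (h\<^sup>2 / 8) *\<^sub>R ?g1)"
    using h_order_diff[OF h_order_diff[OF h_order_mono[OF d2_4 _ F, of 3]
        h_order_monomial_ge[OF order_refl F, of 3 1 48 g2]] h_order_monomial_ge[OF order_refl F, of 3 1 16 "G ?g1"]]
    by (simp add: algebra_simps)
  have d2_2: "h_order F 2 (\<lambda>h. u2 h - ?Yh h)"
    using h_order_diff[OF h_order_mono[OF d2_3 _ F, of 2] h_order_monomial_ge[OF order_refl F, of 2 1 8 ?g1]]
    by (simp add: algebra_simps)
  have fu2: "h_order F 3 (\<lambda>h. f (u2 h) - (f yn + (1 / 2 * h) *\<^sub>R ?g1
      + ((1 / 2 * h)\<^sup>2 / 2) *\<^sub>R g2 - (h\<^sup>2 / 8) *\<^sub>R J ?g1))"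
    using h_order_add[OF h_order_add[OF f_linearize[OF u2(2) nearYh d2_2, unfolded Suc_numeral add_num_simps]
        h_order_bounded_linear[OF d2_3 bounded_linear_J]] fYh]
    by (simp add: J_simps algebra_simps)
  have fu2_2: "h_order F 2 (\<lambda>h. f (u2 h) - (f yn + (1 / 2 * h) *\<^sub>R ?g1))"
    using h_order_diff[OF h_order_add[OF h_order_mono[OF fu2 _ F, of 2]
        h_order_monomial_ge[OF order_refl F, of 2 "1 / 2" 2 g2]] h_order_monomial_ge[OF order_refl F, of 2 1 8 "J ?g1"]]
    by (simp add: algebra_simps)
  obtain u3 where u3: "\<forall>\<^sub>F h in F. \<forall>z. patankar_vec yn (1 / 2 * h) (\<lambda>\<nu>. pds_part p d \<nu> (u2 h)) (\<rho> h) z \<longleftrightarrow> z = u3 h"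
    "near u3"
    "\<And>k. h_order F k (\<lambda>h. u3 h - \<rho> h) \<Longrightarrow>
      h_order F (Suc k) (\<lambda>h. u3 h - (yn + (1 / 2 * h) *\<^sub>R f (u2 h)))"
    "\<And>k v. h_order F (Suc k) (\<lambda>h. u3 h - \<rho> h - (h ^ k) *\<^sub>R v) \<Longrightarrow>
      h_order F (Suc (Suc k)) (\<lambda>h. u3 h - (yn + (1 / 2 * h) *\<^sub>R f (u2 h))
        - (h ^ Suc k) *\<^sub>R ((1 / 2) *\<^sub>R G v))"
    by (rule patankar_stage[of "\<lambda>h \<nu>. pds_part p d \<nu> (u2 h)" \<rho> "1 / 2"])
      (use near_\<rho> part_bounded[OF u2(2)] part_order[OF u2(2)] in \<open>auto simp: f_def\<close>)
  have "h_order F 1 (\<lambda>h. u3 h - \<rho> h)"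
    using h_order_diff[OF u3(2) near_\<rho>] by simp
  from h_order_diff[OF h_order_add[OF u3(3)[OF this, unfolded Suc_1]
        h_order_mult_h[OF f_order[OF u2(2)] Suc_1[symmetric], of "1 / 2"]] \<rho>_2]
  have "h_order F 2 (\<lambda>h. u3 h - \<rho> h)"
    by (rule h_order_eq) (simp add: algebra_simps)
  from u3(3)[OF this] have "h_order F 3 (\<lambda>h. u3 h - (yn + (1 / 2 * h) *\<^sub>R f (u2 h)))"
    by (simp add: eval_nat_numeral)
  \<comment> \<open>Evaluating f at stage 2 produces h^2/4, which exceeds the h^2/8 in
    \<open>\<rho>\<close> by exactly what stage 2 was lacking.\<close>
  from h_order_diff[OF h_order_add[OF this h_order_mult_h[OF fu2_2, of 3 "1 / 2"]] \<rho>_3]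
  have "h_order F (Suc 2) (\<lambda>h. u3 h - \<rho> h - (h ^ 2) *\<^sub>R ((1 / 8) *\<^sub>R ?g1))"
    unfolding eval_nat_numeral(3)[symmetric]
    by (rule h_order_eq) (simp_all add: vec_eq_iff field_simps power2_eq_square)
  from u3(4)[OF this]
  have "h_order F 4 (\<lambda>h. u3 h - (yn + (1 / 2 * h) *\<^sub>R f (u2 h)) - (h ^ 3) *\<^sub>R ((1 / 16) *\<^sub>R G ?g1))"
    unfolding Suc_numeral add_num_simps
    by (rule h_order_eq) (simp_all only: G_scaleR scaleR_scaleR, simp_all)
  from h_order_diff[OF h_order_add[OF this h_order_mult_h[OF fu2, of 4 "1 / 2"]] Yh_4]
  have d3_4: "h_order F 4 (\<lambda>h. (u3 h - ?Yh h) - ((h\<^sup>2 / 8) *\<^sub>R ?g1 + (h ^ 3 / 24) *\<^sub>R g2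
      - (h ^ 3 / 16) *\<^sub>R J ?g1 + (h ^ 3 / 16) *\<^sub>R G ?g1))"
    by (rule h_order_eq) (simp_all add: vec_eq_iff field_simps power2_eq_square power3_eq_cube)
  have d3_3: "h_order F 3 (\<lambda>h. (u3 h - ?Yh h) - (h\<^sup>2 / 8) *\<^sub>R ?g1)"
    using h_order_add[OF h_order_add[OF h_order_diff[OF h_order_mono[OF d3_4 _ F, of 3]
        h_order_monomial_ge[OF order_refl F, of 3 1 16 "J ?g1"]]
        h_order_monomial_ge[OF order_refl F, of 3 1 24 g2]] h_order_monomial_ge[OF order_refl F, of 3 1 16 "G ?g1"]]
    by (simp add: algebra_simps)
  have d3_2: "h_order F 2 (\<lambda>h. u3 h - ?Yh h)"
    using h_order_add[OF h_order_mono[OF d3_3 _ F, of 2] h_order_monomial_ge[OF order_refl F, of 2 1 8 ?g1]]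
    by (simp add: algebra_simps)
  have fu3: "h_order F 3 (\<lambda>h. f (u3 h) - (f yn + (1 / 2 * h) *\<^sub>R ?g1
      + ((1 / 2 * h)\<^sup>2 / 2) *\<^sub>R g2 + (h\<^sup>2 / 8) *\<^sub>R J ?g1))"
    using h_order_add[OF h_order_add[OF f_linearize[OF u3(2) nearYh d3_2, unfolded Suc_numeral add_num_simps]
        h_order_bounded_linear[OF d3_3 bounded_linear_J]] fYh]
    by (simp add: J_simps algebra_simps)
  have fu3_2: "h_order F 2 (\<lambda>h. f (u3 h) - (f yn + (1 / 2 * h) *\<^sub>R ?g1))"
    using h_order_add[OF h_order_add[OF h_order_mono[OF fu3 _ F, of 2]
        h_order_monomial_ge[OF order_refl F, of 2 "1 / 2" 2 g2]] h_order_monomial_ge[OF order_refl F, of 2 1 8 "J ?g1"]]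
    by (simp add: algebra_simps)
  have d23_3: "h_order F 3 (\<lambda>h. (u2 h - ?Yh h) + (u3 h - ?Yh h))"
    using h_order_add[OF d2_3 d3_3] by simp
  obtain u4 where u4: "\<forall>\<^sub>F h in F. \<forall>z. patankar_vec yn (1 * h) (\<lambda>\<nu>. pds_part p d \<nu> (u3 h)) (S h) z \<longleftrightarrow> z = u4 h"
    "near u4"
    "\<And>k. h_order F k (\<lambda>h. u4 h - S h) \<Longrightarrow>
      h_order F (Suc k) (\<lambda>h. u4 h - (yn + (1 * h) *\<^sub>R f (u3 h)))"
    by (rule patankar_stage[of "\<lambda>h \<nu>. pds_part p d \<nu> (u3 h)" S 1])
      (use nearS part_bounded[OF u3(2)] in \<open>auto simp: f_def\<close>)
  have "h_order F 1 (\<lambda>h. u4 h - S h)"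
    using h_order_diff[OF u4(2) nearS] by simp
  from h_order_diff[OF h_order_add[OF u4(3)[OF this, unfolded Suc_1]
        h_order_mult_h[OF f_order[OF u3(2)] Suc_1[symmetric], of 1]] S_2]
  have "h_order F 2 (\<lambda>h. u4 h - S h)"
    by (rule h_order_eq) (simp add: algebra_simps)
  from u4(3)[OF this] have "h_order F 3 (\<lambda>h. u4 h - (yn + (1 * h) *\<^sub>R f (u3 h)))"
    by (simp add: eval_nat_numeral)
  \<comment> \<open>h f(u3) contributes h^2/2 \<open>J (f yn)\<close>, just as in \<open>S\<close>,
    so a third pass of the bootstrap is possible here.\<close>
  from h_order_diff[OF h_order_add[OF this h_order_mult_h[OF fu3_2, of 3 1]] S_3]
  have "h_order F 3 (\<lambda>h. u4 h - S h)"
    by (rule h_order_eq) (simp_all add: vec_eq_iff field_simps power2_eq_square)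
  from u4(3)[OF this] have "h_order F 4 (\<lambda>h. u4 h - (yn + (1 * h) *\<^sub>R f (u3 h)))"
    by (simp add: eval_nat_numeral)
  from h_order_diff[OF h_order_add[OF this h_order_mult_h[OF fu3, of 4 1]] Y_expansion_4[of 1]]
  have d4_4: "h_order F 4 (\<lambda>h. (u4 h - Y (1 * h)) + (h ^ 3 / 24) *\<^sub>R g2 - (h ^ 3 / 8) *\<^sub>R J ?g1)"
    by (rule h_order_eq) (simp_all add: vec_eq_iff field_simps power2_eq_square power3_eq_cube)
  have d4_3: "h_order F 3 (\<lambda>h. u4 h - Y (1 * h))"
    using h_order_add[OF h_order_diff[OF h_order_mono[OF d4_4 _ F, of 3]
        h_order_monomial_ge[OF order_refl F, of 3 1 24 g2]] h_order_monomial_ge[OF order_refl F, of 3 1 8 "J ?g1"]]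
    by (simp add: algebra_simps)
  \<comment> \<open>At order h^3 stages 2 and 3 together leave 1/48 \<open>g2\<close> - 1/16
    \<open>J ?g1\<close>; twice this is the negative of what stage 4 leaves, -1/24 \<open>g2\<close>
    + 1/8 \<open>J ?g1\<close>.\<close>
  have dev: "h_order F 4 (\<lambda>h. 2 *\<^sub>R ((u2 h - ?Yh h) + (u3 h - ?Yh h)) + (u4 h - Y (1 * h)))"
    using h_order_add[OF h_order_scaleR[OF h_order_add[OF d2_4 d3_4], of 2] d4_4]
    by (rule h_order_eq) (simp add: vec_eq_iff field_simps)
  define A where "A h \<nu> = pds_part p d \<nu> yn + 2 *\<^sub>R pds_part p d \<nu> (u2 h)
    + 2 *\<^sub>R pds_part p d \<nu> (u3 h) + pds_part p d \<nu> (u4 h)" for h \<nu>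
  have sumA: "(\<Sum>\<nu>\<in>UNIV. A h \<nu>) = f yn + 2 *\<^sub>R f (u2 h) + 2 *\<^sub>R f (u3 h) + f (u4 h)" for h
    by (simp add: A_def f_def sum.distrib scaleR_sum_right)
  \<comment> \<open>The Taylor polynomial of the mean of f(y) over the step. Simpson's rule
    reproduces it because it is exact for cubics: f at the start, four times the middle, and the end
    give 6 \<open>?Q\<close> up to O(h^4).\<close>
  let ?Q = "\<lambda>h. f yn + (1 / 2 * h) *\<^sub>R ?g1 + (h\<^sup>2 / 6) *\<^sub>R g2 + (h ^ 3 / 24) *\<^sub>R g3"
  have A_4: "h_order F 4 (\<lambda>h. (\<Sum>\<nu>\<in>UNIV. A h \<nu>) - 6 *\<^sub>R ?Q h)"
  proof (rule h_order_eq)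
    \<comment> \<open>Stage 4 deviates only by O(h^3) and can be linearized alone; stages 2 and 3
      deviate by O(h^2) and have to be taken as a pair.\<close>
    have "h_order F 4 (\<lambda>h. f (u4 h) - f (Y (1 * h)) - J (u4 h - Y (1 * h)))"
      using f_linearize[OF u4(2) nearY d4_3] by simp
    moreover have "h_order F 4 (\<lambda>h. (f (u2 h) - f (?Yh h)) + (f (u3 h) - f (?Yh h))
        - J ((u2 h - ?Yh h) + (u3 h - ?Yh h)))"
      unfolding J_def
      by (rule h_order_linearize_pair[OF open_positive_orthant smooth_f yn F nearYh u2(2) u3(2) d2_2 d3_2 d23_3])
    ultimately show "h_order F 4 (\<lambda>h.
        2 *\<^sub>R ((f (u2 h) - f (?Yh h)) + (f (u3 h) - f (?Yh h)) - J ((u2 h - ?Yh h) + (u3 h - ?Yh h)))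
        + (f (u4 h) - f (Y (1 * h)) - J (u4 h - Y (1 * h)))
        + J (2 *\<^sub>R ((u2 h - ?Yh h) + (u3 h - ?Yh h)) + (u4 h - Y (1 * h)))
        + 4 *\<^sub>R (f (?Yh h) - (f yn + (1 / 2 * h) *\<^sub>R ?g1 + ((1 / 2 * h)\<^sup>2 / 2) *\<^sub>R g2 + ((1 / 2 * h) ^ 3 / 6) *\<^sub>R g3))
        + (f (Y (1 * h)) - (f yn + (1 * h) *\<^sub>R ?g1 + ((1 * h)\<^sup>2 / 2) *\<^sub>R g2 + ((1 * h) ^ 3 / 6) *\<^sub>R g3)))"
      by (intro h_order_add h_order_scaleR f_expansion h_order_bounded_linear[OF dev bounded_linear_J]) simp_all
  qed (simp only: sumA J_simps, simp add: vec_eq_iff field_simps power2_eq_square power3_eq_cube)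
  obtain Z where Z: "\<forall>\<^sub>F h in F. \<forall>z. patankar_vec yn (1 / 6 * h) (A h) (\<sigma> h) z \<longleftrightarrow> z = Z h"
    "near Z"
    "\<And>k. h_order F k (\<lambda>h. Z h - \<sigma> h) \<Longrightarrow>
      h_order F (Suc k) (\<lambda>h. Z h - (yn + (1 / 6 * h) *\<^sub>R (\<Sum>\<nu>\<in>UNIV. A h \<nu>)))"
  proof (rule patankar_stage[of A \<sigma> "1 / 6"])
    show "h_order F 0 (\<lambda>h. A h \<nu>)" for \<nu>
      unfolding A_def
      by (intro h_order_add h_order_scaleR h_order_const part_bounded u2(2) u3(2) u4(2))
  qed (rule near_\<sigma>, rule that)
  let ?T = "\<lambda>h. yn + h *\<^sub>R f yn + (h\<^sup>2 / 2) *\<^sub>R ?g1 + (h ^ 3 / 6) *\<^sub>R g2 + (h ^ 4 / 24) *\<^sub>R g3"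
  have step: "h_order F (Suc k) (\<lambda>h. Z h - ?T h)" if "h_order F k (\<lambda>h. Z h - \<sigma> h)" "Suc k \<le> 5" for k
  proof (rule h_order_eq)
    show "h_order F (Suc k) (\<lambda>h. Z h - (yn + (1 / 6 * h) *\<^sub>R (\<Sum>\<nu>\<in>UNIV. A h \<nu>))
        + (1 / 6 * h) *\<^sub>R ((\<Sum>\<nu>\<in>UNIV. A h \<nu>) - 6 *\<^sub>R ?Q h))"
      using h_order_mono[OF h_order_mult_h[OF A_4, of 5 "1 / 6"] that(2) F]
      by (intro h_order_add Z(3) that(1)) simp
  qed (simp add: vec_eq_iff field_simps eval_nat_numeral)
  have \<sigma>_T: "h_order F 4 (\<lambda>h. \<sigma> h - ?T h)"
    using h_order_diff[OF \<sigma>_4 h_order_monomial_ge[OF order_refl F, of 4 1 24 g3]]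
    by (rule h_order_eq) simp
  \<comment> \<open>\<open>\<sigma>\<close> is accurate to O(h^4) only, so the bootstrap stops at
    \<open>Z - \<sigma>\<close> of that order; the factor h in front of the weight perturbation
    supplies the fifth power.\<close>
  have improve: "h_order F (Suc k) (\<lambda>h. Z h - \<sigma> h)" if "h_order F k (\<lambda>h. Z h - \<sigma> h)" "Suc k \<le> 4" for k
    using h_order_diff[OF step[OF that(1)] h_order_mono[OF \<sigma>_T that(2) F]] that(2) by simp
  have "h_order F 1 (\<lambda>h. Z h - \<sigma> h)"
    using h_order_diff[OF Z(2) near_\<sigma>] by simp
  from step[OF improve[OF improve[OF improve[OF this]]]] have "h_order F 5 (\<lambda>h. Z h - ?T h)"
    by (simp add: eval_nat_numeral)
  from h_order_diff[OF this Y_expansion[of 1]] have Z_5: "h_order F 5 (\<lambda>h. Z h - Y (1 * h))"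
    by simp
  have "\<forall>\<^sub>F h in F. \<forall>z. rk4_stages p d yn h (\<rho> h) (\<rho> h) (S h) (\<sigma> h) z \<longleftrightarrow> z = Z h"
    using u2(1) u3(1) u4(1) Z(1) eventually_positive_orthant[OF F yn u2(2)]
      eventually_positive_orthant[OF F yn u3(2)] eventually_positive_orthant[OF F yn u4(2)]
  proof eventually_elim
    case (elim h)
    have e2: "patankar_eq yn (1 / 2 * h) (\<lambda>k \<nu>. p k \<nu> yn) (\<lambda>k \<nu>. d k \<nu> yn) (\<rho> h) y2 \<longleftrightarrow> y2 = u2 h" for y2
      using elim(1) by (simp add: patankar_eq_part[OF yn])
    have e3: "patankar_eq yn (1 / 2 * h) (\<lambda>k \<nu>. p k \<nu> (u2 h)) (\<lambda>k \<nu>. d k \<nu> (u2 h)) (\<rho> h) y3 \<longleftrightarrow> y3 = u3 h" for y3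
      using elim(2,5) by (simp add: patankar_eq_part)
    have e4: "patankar_eq yn h (\<lambda>k \<nu>. p k \<nu> (u3 h)) (\<lambda>k \<nu>. d k \<nu> (u3 h)) (S h) y4 \<longleftrightarrow> y4 = u4 h" for y4
      using elim(3,6) by (simp add: patankar_eq_part)
    have e5: "patankar_eq yn (1 / 6 * h)
        (\<lambda>k \<nu>. p k \<nu> yn + 2 * p k \<nu> (u2 h) + 2 * p k \<nu> (u3 h) + p k \<nu> (u4 h))
        (\<lambda>k \<nu>. d k \<nu> yn + 2 * d k \<nu> (u2 h) + 2 * d k \<nu> (u3 h) + d k \<nu> (u4 h)) (\<sigma> h) z \<longleftrightarrow> z = Z h" for z
      using elim(4) patankar_eq_parts4[OF yn elim(5-7)] by (simp add: A_def[abs_def])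
    show ?case
      unfolding rk4_stages_def
      by (auto simp only: e2 e3 e4 e5)
        (rule exI[of _ "u2 h"], rule exI[of _ "u3 h"], rule exI[of _ "u4 h"], simp only: e2 e3 e4 e5 simp_thms)
  qed
  then show ?thesis
    using that Z_5 by blast
qed

end

section \<open>Taylor data of a solution and the order of the scheme\<close>

lemma convex_shifted_interval:
  assumes "is_interval (I :: real set)"
  shows "convex {h. t0 + h \<in> I}"
proof -
  have "{h. t0 + h \<in> I} = (\<lambda>x. - t0 + x) ` I"
    by (force simp: image_iff)
  then show ?thesis
    using assms by (simp add: is_interval_convex_1 convex_translation)
qed

text \<open>A convex \<open>T\<close> containing 0 contains a h together with h, so the intermediate
  nodes stay where the solution is controlled, also for one-sided or negative steps.\<close>

lemma h_order_rescale:
  assumes "convex T" "0 \<in> T" "\<forall>\<^sub>F h in F. h \<in> T" "0 \<le> a" "a \<le> 1" "0 \<le> B"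
    and bound: "\<And>s. s \<in> T \<Longrightarrow> norm (R s) \<le> B * \<bar>s\<bar> ^ n"
  shows "h_order F n (\<lambda>h. R (a * h))"
proof -
  have "\<forall>\<^sub>F h in F. norm (R (a * h)) \<le> B * \<bar>h\<bar> ^ n"
    using assms(3)
  proof eventually_elim
    case (elim h)
    have "a * h \<in> T"
      using convexD[OF assms(1) elim assms(2), of a "1 - a"] assms(4,5) by simp
    moreover have "B * \<bar>a * h\<bar> ^ n \<le> B * \<bar>h\<bar> ^ n"
      using assms(4,5) by (intro mult_left_mono power_mono assms(6)) (auto simp: abs_mult mult_left_le_one_le)
    ultimately show ?case using bound by fastforce
  qed
  then show ?thesis by (auto simp: h_order_def)
qed

lemma (in patankar_scheme) pds_rhs_eq_f:
  assumes "x \<in> positive_orthant"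
  shows "pds_rhs p d x = f x"
proof -
  have zero: "p k k x = 0" for k using assms pd by (simp add: production_destruction_def)
  have "(\<Sum>\<nu>\<in>UNIV. pds_part p d \<nu> x $ m)
      = (\<Sum>\<nu>\<in>UNIV. p m \<nu> x - (if \<nu> = m then (\<Sum>j\<in>UNIV. d m j x) else 0))" for m
    by (intro sum.cong) (auto simp: pds_part_def zero)
  then show ?thesis
    by (simp add: vec_eq_iff pds_rhs_def f_def sum_subtractf)
qed

text \<open>The derivatives of the solution are iterated Lie derivatives of f along it. Taylor's
  formula is used twice on this one family, for y and, shifted by one, for f(y), which is why the
  coefficients of the two expansions coincide.\<close>

lemma (in patankar_scheme) solution_expansion:
  assumes f5: "Ck_on 5 positive_orthant f"
    and I: "is_interval I" "t0 \<in> I" and F_eq: "F = at 0 within {h. t0 + h \<in> I}"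
    and y0: "y t0 = yn"
    and deriv: "\<forall>t\<in>I. (y has_vector_derivative pds_rhs p d (y t)) (at t within I)"
  shows "\<exists>g2 g3. patankar_scheme_solution p d yn F (\<lambda>s. y (t0 + s)) g2 g3"
proof -
  define S where "S = {h. t0 + h \<in> I}"
  define D where "D i = (lie_derivative f ^^ i) f" for i
  \<comment> \<open>The index is offset by one: \<open>\<phi> 0\<close> is the solution, and
    \<open>\<phi> (Suc j)\<close> is its derivative of order j + 1, since \<open>D 0\<close> is
    f.\<close>
  define \<phi> where "\<phi> i s = (case i of 0 \<Rightarrow> y (t0 + s) | Suc j \<Rightarrow> D j (y (t0 + s)))" for i s
  have D: "Ck_on (5 - i) positive_orthant (D i)" if "i \<le> 5" for i
    unfolding D_def by (rule Ck_on_lie_derivative_iterate[OF open_positive_orthant f5 that])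
  have shift: "((\<lambda>s. y (t0 + s)) has_vector_derivative pds_rhs p d (y (t0 + s))) (at s within S)"
    if "s \<in> S" for s
  proof -
    have "((\<lambda>s. t0 + s) has_vector_derivative 1) (at s within S)"
      by (auto intro!: derivative_eq_intros)
    moreover have "(y has_vector_derivative pds_rhs p d (y (t0 + s))) (at (t0 + s) within (\<lambda>s. t0 + s) ` S)"
      by (rule has_vector_derivative_within_subset[OF bspec[OF deriv]])
        (use that in \<open>auto simp: S_def\<close>)
    ultimately have "(y \<circ> (\<lambda>s. t0 + s) has_vector_derivative 1 *\<^sub>R pds_rhs p d (y (t0 + s))) (at s within S)"
      by (rule vector_diff_chain_within)
    then show ?thesis by (simp add: o_def)
  qed
  have "0 \<in> S" using I(2) by (simp add: S_def)
  have "((\<lambda>s. y (t0 + s)) \<longlongrightarrow> yn) F"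
    using has_vector_derivative_continuous[OF shift[OF \<open>0 \<in> S\<close>]] y0
    by (simp add: continuous_within F_eq S_def)
  moreover have "continuous_on positive_orthant (D 4)"
    using Ck_on_mono[OF D[of 4], of 0] by simp
  then have "isCont (D 4) yn"
    using continuous_on_eq_continuous_at[OF open_positive_orthant] yn by blast
  ultimately have lim: "((\<lambda>s. y (t0 + s)) \<longlongrightarrow> yn) F" "((\<lambda>s. D 4 (y (t0 + s))) \<longlongrightarrow> D 4 yn) F"
    by (auto intro: isCont_tendsto_compose)
  have "\<forall>\<^sub>F s in F. y (t0 + s) \<in> positive_orthant \<and> norm (D 4 (y (t0 + s))) < norm (D 4 yn) + 1"
    using topological_tendstoD[OF lim(1) open_positive_orthant yn]
      order_tendstoD(2)[OF tendsto_norm[OF lim(2)], of "norm (D 4 yn) + 1"]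
    by (auto intro: eventually_conj)
  \<comment> \<open>The filter says nothing about s = 0; that point is covered separately by the
    initial value.\<close>
  then obtain r where r: "0 < r" "\<And>s. s \<in> S \<Longrightarrow> s \<noteq> 0 \<Longrightarrow> \<bar>s\<bar> < r \<Longrightarrow>
      y (t0 + s) \<in> positive_orthant \<and> norm (D 4 (y (t0 + s))) < norm (D 4 yn) + 1"
    by (auto simp: F_eq S_def eventually_at dist_real_def)
  \<comment> \<open>On this neighbourhood the solution stays positive, so its right-hand side is f
    and the chain rule applies, and its fifth derivative is bounded by \<open>B\<close>.\<close>
  define T where "T = S \<inter> ball 0 r"
  define B where "B = norm (D 4 yn) + 1"
  have T_props: "y (t0 + s) \<in> positive_orthant \<and> norm (\<phi> 5 s) \<le> B" if "s \<in> T" for s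
    using r(2)[of s] that yn y0
    by (cases "s = 0") (auto simp: \<phi>_def T_def B_def dist_real_def eval_nat_numeral)
  have T: "convex T" "0 \<in> T" "0 \<le> B"
    using convex_shifted_interval[OF I(1), of t0] \<open>0 \<in> S\<close> r(1)
    by (auto simp: T_def S_def B_def intro: convex_Int add_nonneg_nonneg)
  have evT: "\<forall>\<^sub>F h in F. h \<in> T"
    using r(1) by (auto simp: F_eq S_def T_def eventually_at dist_real_def)
  have der: "(\<phi> i has_vector_derivative \<phi> (Suc i) s) (at s within T)" if "i < 5" "s \<in> T" for i s
  proof -
    have y': "((\<lambda>s. y (t0 + s)) has_vector_derivative f (y (t0 + s))) (at s within T)"
      using has_vector_derivative_within_subset[OF shift, of s T] that(2) T_props[OF that(2)]
      by (simp add: T_def pds_rhs_eq_f)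
    show ?thesis
    proof (cases i)
      case 0
      then show ?thesis using y' by (simp add: \<phi>_def[abs_def] D_def)
    next
      case (Suc j)
      then have "Ck_on (Suc 0) positive_orthant (D j)"
        using that(1) by (intro Ck_on_mono[OF D[of j]]) auto
      then have "(D j has_derivative frechet_derivative (D j) (at (y (t0 + s)))) (at (y (t0 + s)))"
        by (rule Ck_on_SucD) (use T_props[OF that(2)] in blast)
      from vector_derivative_diff_chain_within[OF y' has_derivative_at_withinI[OF this]]
      show ?thesis
        by (simp add: Suc \<phi>_def[abs_def] o_def D_def lie_derivative_def)
    qed
  qed
  have \<phi>0: "\<phi> 0 0 = yn" "\<phi> 1 0 = f yn" "\<phi> 2 0 = J (f yn)"
    using y0 by (simp_all add: \<phi>_def D_def lie_derivative_def J_def numeral_2_eq_2)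
  have Y5: "norm (y (t0 + s) - (yn + s *\<^sub>R f yn + (s\<^sup>2 / 2) *\<^sub>R J (f yn)
      + (s ^ 3 / 6) *\<^sub>R \<phi> 3 0 + (s ^ 4 / 24) *\<^sub>R \<phi> 4 0)) \<le> B * \<bar>s\<bar> ^ 5" if "s \<in> T" for s
  proof -
    have "(\<Sum>i<5. (s ^ i / fact i) *\<^sub>R \<phi> i 0) = yn + s *\<^sub>R f yn + (s\<^sup>2 / 2) *\<^sub>R J (f yn)
      + (s ^ 3 / 6) *\<^sub>R \<phi> 3 0 + (s ^ 4 / 24) *\<^sub>R \<phi> 4 0"
      using \<phi>0 by (simp add: lessThan_nat_numeral fact_numeral algebra_simps)
    moreover have "\<phi> 0 s = y (t0 + s)" by (simp add: \<phi>_def)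
    ultimately show ?thesis
      using Taylor_vector_within[OF T, of 5 \<phi> s] der that T_props by simp
  qed
  \<comment> \<open>The family shifted by one ends at the same bounded member
    \<open>\<phi> 5\<close>, so the constant \<open>B\<close> serves again, with one power
    less.\<close>
  have f4: "norm (f (y (t0 + s)) - (f yn + s *\<^sub>R J (f yn) + (s\<^sup>2 / 2) *\<^sub>R \<phi> 3 0
      + (s ^ 3 / 6) *\<^sub>R \<phi> 4 0)) \<le> B * \<bar>s\<bar> ^ 4" if "s \<in> T" for s
  proof -
    have "(\<Sum>i<4. (s ^ i / fact i) *\<^sub>R \<phi> (Suc i) 0) = f yn + s *\<^sub>R J (f yn) + (s\<^sup>2 / 2) *\<^sub>R \<phi> 3 0
      + (s ^ 3 / 6) *\<^sub>R \<phi> 4 0"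
      using \<phi>0 by (simp add: numeral_2_eq_2[symmetric] lessThan_nat_numeral fact_numeral algebra_simps)
    moreover have "\<phi> (Suc 0) s = f (y (t0 + s))" by (simp add: \<phi>_def D_def)
    ultimately show ?thesis
      using Taylor_vector_within[OF T, of 4 "\<lambda>i. \<phi> (Suc i)" s] der that T_props by simp
  qed
  have "patankar_scheme_solution p d yn F (\<lambda>s. y (t0 + s)) (\<phi> 3 0) (\<phi> 4 0)"
    by unfold_locales
      (rule h_order_rescale[OF T(1,2) evT _ _ T(3) Y5] h_order_rescale[OF T(1,2) evT _ _ T(3) f4]; assumption)+
  then show ?thesis by blast
qed

theorem mainTheorem14:
  fixes p d :: "'n::finite rates"
  assumes "production_destruction p d"
    and "\<And>\<nu>. \<exists>L. L-lipschitz_on positive_orthant (pds_part p d \<nu>)"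
    and "\<And>\<nu>. Ck_on 5 positive_orthant (pds_part p d \<nu>)"
  shows "has_order (pds_rhs p d) (mprk4_step p d) 4"
  unfolding has_order_def
proof (intro allI impI, elim conjE)
  fix I :: "real set" and y :: "real \<Rightarrow> real ^ 'n" and t0 :: real
  assume I: "is_interval I" "t0 \<in> I" and y0: "y t0 \<in> positive_orthant"
    and deriv: "\<forall>t\<in>I. (y has_vector_derivative pds_rhs p d (y t)) (at t within I)"
  \<comment> \<open>This filter is one-sided, two-sided or, for an interval consisting of one point,
    trivial; the estimates hold in all three cases.\<close>
  define F where "F = at 0 within {h. t0 + h \<in> I}"
  interpret patankar_scheme p d "y t0" F
    using assms(1) y0 Ck_on_mono[OF assms(3)]
    by unfold_locales (auto simp: F_def at_within_le_nhds simp del: Ck_on.simps)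
  have "Ck_on 5 positive_orthant f"
    unfolding f_def[abs_def] by (intro Ck_on_sum open_positive_orthant assms(3))
  then obtain g2 g3 where "patankar_scheme_solution p d (y t0) F (\<lambda>s. y (t0 + s)) g2 g3"
    using solution_expansion[OF _ I F_def _ deriv] by blast
  then interpret patankar_scheme_solution p d "y t0" F "\<lambda>s. y (t0 + s)" g2 g3 .
  obtain Y2 S where S: "\<forall>\<^sub>F h in F. \<forall>y2 s. hat_sigma p d (y t0) (1 * h) y2 s \<longleftrightarrow> y2 = Y2 h \<and> s = S h"
    "near Y2" "near S"
    "h_order F 2 (\<lambda>h. Y2 h - (y t0 + (1 / 2 * h) *\<^sub>R f (y t0)))"
    "h_order F 3 (\<lambda>h. Y2 h - (y t0 + (1 / 2 * h) *\<^sub>R f (y t0) + ((1 * h)\<^sup>2 / 4) *\<^sub>R G (f (y t0))))"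
    "h_order F 2 (\<lambda>h. f (Y2 h) - (f (y t0) + (1 / 2 * h) *\<^sub>R J (f (y t0))))"
    "h_order F 3 (\<lambda>h. S h - (y t0 + (1 * h) *\<^sub>R f (y t0) + ((1 * h)\<^sup>2 / 2) *\<^sub>R J (f (y t0))))"
    by (rule hat_sigma_expansion[of 1]) (rule that)
  \<comment> \<open>The half-step weight comes from its own auxiliary stage \<open>Y2'\<close>,
    computed with h/2, and not from \<open>Y2\<close>.\<close>
  obtain Y2' \<rho> where \<rho>: "\<forall>\<^sub>F h in F. \<forall>y2 s. hat_sigma p d (y t0) (1 / 2 * h) y2 s \<longleftrightarrow> y2 = Y2' h \<and> s = \<rho> h"
    "near \<rho>"
    "h_order F 3 (\<lambda>h. \<rho> h - (y t0 + (1 / 2 * h) *\<^sub>R f (y t0) + ((1 / 2 * h)\<^sup>2 / 2) *\<^sub>R J (f (y t0))))"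
    by (rule hat_sigma_expansion[of "1 / 2"]) (rule that)
  obtain \<sigma> where \<sigma>: "\<forall>\<^sub>F h in F. \<forall>z. hat_next p d (y t0) h (Y2 h) (S h) z \<longleftrightarrow> z = \<sigma> h"
    "near \<sigma>"
    "h_order F 4 (\<lambda>h. \<sigma> h - (y t0 + h *\<^sub>R f (y t0) + (h\<^sup>2 / 2) *\<^sub>R J (f (y t0)) + (h ^ 3 / 6) *\<^sub>R g2))"
    by (rule hat_next_expansion[OF S(2-7)]) (rule that)
  obtain Z where Z: "\<forall>\<^sub>F h in F. \<forall>z. rk4_stages p d (y t0) h (\<rho> h) (\<rho> h) (S h) (\<sigma> h) z \<longleftrightarrow> z = Z h"
    "h_order F 5 (\<lambda>h. Z h - y (t0 + 1 * h))"
    by (rule rk4_expansion[OF \<rho>(2) S(3) \<sigma>(2) \<rho>(3) S(7) \<sigma>(3)]) (rule that)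
  show "\<exists>Y. (\<forall>\<^sub>F h in at 0 within {h. t0 + h \<in> I}. \<forall>z. mprk4_step p d (y t0) h z \<longleftrightarrow> z = Y h) \<and>
      (\<lambda>h. norm (Y h - y (t0 + h))) \<in> O[at 0 within {h. t0 + h \<in> I}](\<lambda>h. h ^ (4 + 1))"
    unfolding F_def[symmetric]
  proof (intro exI conjI)
    \<comment> \<open>For small h each system determines its unknown, so the nested existentials of
      the step collapse to the single result \<open>Z h\<close>.\<close>
    show "\<forall>\<^sub>F h in F. \<forall>z. mprk4_step p d (y t0) h z \<longleftrightarrow> z = Z h"
      using S(1) \<rho>(1) \<sigma>(1) Z(1)
    proof eventually_elim
      case (elim h)
      then show ?case
        unfolding mprk4_step_def
        by (auto simp only: mult_1) (rule exI[of _ "Y2 h"], rule exI[of _ "S h"], rule exI[of _ "Y2' h"],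
          rule exI[of _ "\<rho> h"], rule exI[of _ "\<sigma> h"], simp only: simp_thms)
    qed
    obtain C where "\<forall>\<^sub>F h in F. norm (Z h - y (t0 + 1 * h)) \<le> C * \<bar>h\<bar> ^ 5"
      using Z(2) by (auto simp: h_order_def)
    then show "(\<lambda>h. norm (Z h - y (t0 + h))) \<in> O[F](\<lambda>h. h ^ (4 + 1))"
      by (intro bigoI[of _ C]) (simp add: power_abs)
  qed
qed

end
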